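(* Let $\mathscr{G}_7$ be the set of all connected graphs that induce an odd cycle of length $7$ or more, but induce no $5$-cycle and no pendant graph, and let $\mathscr{G}_7^c$ be its complement in the set of connected graphs. If $G\in\mathscr{G}_7^c$ is such that $\mathrm{Ncond}(G)$ is non-empty and the uniform matching policy $\mathrm U$ is maximal on $G$, then $G$ is separable of order $q$ for some $q\ge3$.
   Context: Graphs $G=(\mathcal V,\mathcal E)$ are finite, undirected and simple. $\mathcal E(A)$ is the set of nodes adjacent to at least one node of $A\subset\mathcal V$, $\mathcal E(i)=\mathcal E(\{i\})$. $G$ induces $H$ if $H$ is (isomorphic to) an induced subgraph of $G$. The pendant graph is the graph on $\{1,2,3,4\}$ with edges $12,13,23,34$. $G$ is separable of order $q\ge2$ if $\mathcal V$ can be partitioned into maximal independent sets $\mathcal I_1,\dots,\mathcal I_q$ such that every $u\in\mathcal I_i$ is adjacent to every $v\in\mathcal I_j$ whenever $i\neq j$. Matching queue $(G,\lambda,\Phi)$: items of class $i\in\mathcal V$ arrive according to independent Poisson processes with intensities $\lambda_i>0$. An arriving class-$i$ item is matched immediately with exactly one queued item of some class in $\mathcal E(i)$ if there is one (both items leave at once); otherwise it is queued. The policy $\Phi$ determines the class of the match when several are possible. $Q_i(t)$ is the number of queued class-$i$ items at time $t$; $Q=(Q_i)_{i\in\mathcal V}$ is a continuous-time Markov chain, and the matching queue is stable if $Q$ is positive recurrent. Uniform policy $\mathrm U$: when a class-$i$ item arrives at time $t$, let $\mathcal U_i(t)=\{j\in\mathcal E(i):Q_j(t)>0\}$ (queue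 contents found by the arriving item). If $\mathcal U_i(t)=\emptyset$ the item is queued; otherwise it is matched with a class-$j$ item with probability $1/|\mathcal U_i(t)|$ for each $j\in\mathcal U_i(t)$ (independently of everything else). $\mathrm{Ncond}(G)=\{\lambda\in(0,\infty)^{|\mathcal V|}:\ \sum_{i\in\mathcal I}\lambda_i<\sum_{j\in\mathcal E(\mathcal I)}\lambda_j\text{ for every non-empty independent set }\mathcal I\text{ of }G\}$. A policy $\Phi$ is maximal on $G$ if the set of $\lambda\in(0,\infty)^{|\mathcal V|}$ for which $(G,\lambda,\Phi)$ is stable equals $\mathrm{Ncond}(G)$. *)

theory Defs
  imports "HOL-Probability.Probability" "Graph_Theory.Graph_Theory"
begin

section \<open>Graphs\<close>

text \<open>Finite undirected simple graphs are the symmetric loop-free finite digraphs \<^const>\<open>pair_graph\<close>;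
  the edge \<open>ij\<close> is the pair of arcs \<open>(i, j)\<close>, \<open>(j, i)\<close>.\<close>

definition nbrs :: "'v pair_pre_digraph \<Rightarrow> 'v set \<Rightarrow> 'v set" where
  "nbrs G A = parcs G `` A"

definition independent_set :: "'v pair_pre_digraph \<Rightarrow> 'v set \<Rightarrow> bool" where
  "independent_set G I \<longleftrightarrow> I \<subseteq> pverts G \<and> (\<forall>i\<in>I. \<forall>j\<in>I. (i, j) \<notin> parcs G)"

definition maximal_independent_set :: "'v pair_pre_digraph \<Rightarrow> 'v set \<Rightarrow> bool" where
  "maximal_independent_set G I \<longleftrightarrow>
     independent_set G I \<and> (\<forall>J. independent_set G J \<and> I \<subseteq> J \<longrightarrow> J = I)"

definition separable :: "'v pair_pre_digraph \<Rightarrow> nat \<Rightarrow> bool" where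
  "separable G q \<longleftrightarrow> 2 \<le> q \<and>
     (\<exists>P. partition_on (pverts G) P \<and> card P = q \<and> (\<forall>I\<in>P. maximal_independent_set G I) \<and>
          (\<forall>I\<in>P. \<forall>J\<in>P. I \<noteq> J \<longrightarrow> (\<forall>u\<in>I. \<forall>v\<in>J. (u, v) \<in> parcs G)))"

definition induces :: "'v pair_pre_digraph \<Rightarrow> 'w pair_pre_digraph \<Rightarrow> bool" where
  "induces G H \<longleftrightarrow>
     (\<exists>K. induced_subgraph K (with_proj G) \<and> digraph_iso K (with_proj H))"

text \<open>For \<open>n \<ge> 3\<close>, the cycle of length \<open>n\<close>.\<close>

definition cycle_graph :: "nat \<Rightarrow> nat pair_pre_digraph" where
  "cycle_graph n = \<lparr> pverts = {..<n},
     parcs = {(i, j). i < n \<and> j < n \<and> (j = (i + 1) mod n \<or> i = (j + 1) mod n)} \<rparr>"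

definition pendant_graph :: "nat pair_pre_digraph" where
  "pendant_graph = \<lparr> pverts = {1, 2, 3, 4},
     parcs = symcl {(1, 2), (1, 3), (2, 3), (3, 4)} \<rparr>"

definition connected_graphs :: "'v pair_pre_digraph set" where
  "connected_graphs = {G. pair_graph G \<and> Digraph_Component.connected (with_proj G)}"

definition G7 :: "'v pair_pre_digraph set" where
  "G7 = {G \<in> connected_graphs.
     (\<exists>n\<ge>7. odd n \<and> induces G (cycle_graph n)) \<and>
     \<not> induces G (cycle_graph 5) \<and> \<not> induces G pendant_graph}"

definition G7c :: "'v pair_pre_digraph set" where
  "G7c = connected_graphs - G7"


section \<open>Continuous-time Markov chains\<close>

text \<open>
  A chain is given by its transition rates \<open>q x y\<close>, \<open>x \<noteq> y\<close>. A path is a pair \<open>(Y, E)\<close> with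
  \<open>Y\<close> the jump chain and \<open>E\<close> an independent sequence of independent standard exponential
  variables: the \<open>n\<close>-th state visited is \<open>Y n\<close>, and the time spent there is
  \<open>E n / exit_rate q (Y n)\<close>, which is exponential with parameter \<open>exit_rate q (Y n)\<close> given \<open>Y\<close>.
\<close>

definition exit_rate :: "('s \<Rightarrow> 's \<Rightarrow> real) \<Rightarrow> 's \<Rightarrow> real" where
  "exit_rate q x = infsum (q x) (- {x})"

definition jump_pmf :: "('s \<Rightarrow> 's \<Rightarrow> real) \<Rightarrow> 's \<Rightarrow> 's pmf" where
  "jump_pmf q x = (if exit_rate q x = 0 then return_pmf x
     else embed_pmf (\<lambda>y. if y = x then 0 else q x y / exit_rate q x))"

definition jump_kernel :: "('s \<Rightarrow> 's \<Rightarrow> real) \<Rightarrow> 's \<Rightarrow> nat \<Rightarrow> (nat \<Rightarrow> 's) \<Rightarrow> 's measure" where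
  "jump_kernel q x n Y = measure_pmf (if n = 0 then return_pmf x else jump_pmf q (Y (n - 1)))"

lemma Ionescu_Tulcea_jump_kernel:
  "Ionescu_Tulcea (jump_kernel q x) (\<lambda>_. count_space UNIV)"
proof (rule Ionescu_Tulcea.intro)
  fix n :: nat
  show "jump_kernel q x n \<in> PiM {0..<n} (\<lambda>_. count_space UNIV) \<rightarrow>\<^sub>M
      subprob_algebra (count_space UNIV)"
  proof (cases n)
    case 0
    then show ?thesis
      by (auto simp: jump_kernel_def[abs_def] measure_pmf_in_subprob_algebra)
  next
    case (Suc m)
    have "(\<lambda>Y. measure_pmf (jump_pmf q (Y m))) \<in> PiM {0..<n} (\<lambda>_. count_space UNIV) \<rightarrow>\<^sub>M
        subprob_algebra (count_space UNIV)"
      by (rule measurable_compose[of "\<lambda>Y. Y m" _ "count_space UNIV"])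
        (auto simp: Suc intro!: measurable_component_singleton measure_pmf_in_subprob_algebra)
    then show ?thesis
      by (simp add: jump_kernel_def[abs_def] Suc)
  qed
qed (simp add: jump_kernel_def measure_pmf.prob_space_axioms)

definition jump_chain_law :: "('s \<Rightarrow> 's \<Rightarrow> real) \<Rightarrow> 's \<Rightarrow> (nat \<Rightarrow> 's) measure" where
  "jump_chain_law q x = projective_family.lim UNIV
     (Ionescu_Tulcea.CI (jump_kernel q x) (\<lambda>_. count_space UNIV)) (\<lambda>_. count_space UNIV)"

definition path_law :: "('s \<Rightarrow> 's \<Rightarrow> real) \<Rightarrow> 's \<Rightarrow> ((nat \<Rightarrow> 's) \<times> (nat \<Rightarrow> real)) measure" where
  "path_law q x =
     jump_chain_law q x \<Otimes>\<^sub>M PiM UNIV (\<lambda>_. density lborel (exponential_density 1))"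

definition jump_time ::
    "('s \<Rightarrow> 's \<Rightarrow> real) \<Rightarrow> (nat \<Rightarrow> 's) \<times> (nat \<Rightarrow> real) \<Rightarrow> nat \<Rightarrow> real" where
  "jump_time q \<omega> n = (\<Sum>k<n. snd \<omega> k / exit_rate q (fst \<omega> k))"

text \<open>The first time \<open>t\<close>, not before the first jump, at which the chain is in state \<open>x\<close>
  (\<open>\<infinity>\<close> if there is none). The chain is in state \<open>fst \<omega> n\<close> between the \<open>n\<close>-th and the
  next jump; an absorbing state yields no such interval, as \<open>E n / 0 = 0\<close>, and is treated apart
  below.\<close>

definition return_time ::
    "('s \<Rightarrow> 's \<Rightarrow> real) \<Rightarrow> 's \<Rightarrow> (nat \<Rightarrow> 's) \<times> (nat \<Rightarrow> real) \<Rightarrow> ennreal" where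
  "return_time q x \<omega> = Inf {ennreal t | t n. jump_time q \<omega> 1 \<le> t \<and>
     jump_time q \<omega> n \<le> t \<and> t < jump_time q \<omega> (Suc n) \<and> fst \<omega> n = x}"

definition positive_recurrent_state :: "('s \<Rightarrow> 's \<Rightarrow> real) \<Rightarrow> 's \<Rightarrow> bool" where
  "positive_recurrent_state q x \<longleftrightarrow>
     exit_rate q x = 0 \<or> (\<integral>\<^sup>+ \<omega>. return_time q x \<omega> \<partial>path_law q x) < \<infinity>"

definition positive_recurrent :: "'s set \<Rightarrow> ('s \<Rightarrow> 's \<Rightarrow> real) \<Rightarrow> bool" where
  "positive_recurrent S q \<longleftrightarrow> (\<forall>x\<in>S. positive_recurrent_state q x)"


section \<open>Matching queues\<close>

text \<open>
  A state \<open>x\<close> gives the number \<open>x i\<close> of queued items of each class \<open>i\<close>. A policy gives, for a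
  state \<open>x\<close> and the class \<open>i\<close> of an item arriving in it, the law of the class of its match; it
  is only used if there is a possible match, and must then be concentrated on
  \<open>candidates G x i\<close>.
\<close>

type_synonym 'v policy = "('v \<Rightarrow> nat) \<Rightarrow> 'v \<Rightarrow> 'v pmf"

definition candidates :: "'v pair_pre_digraph \<Rightarrow> ('v \<Rightarrow> nat) \<Rightarrow> 'v \<Rightarrow> 'v set" where
  "candidates G x i = {j \<in> nbrs G {i}. x j > 0}"

definition uniform_policy :: "'v pair_pre_digraph \<Rightarrow> 'v policy" where
  "uniform_policy G x i = pmf_of_set (candidates G x i)"

definition after_arrival ::
    "'v pair_pre_digraph \<Rightarrow> 'v policy \<Rightarrow> ('v \<Rightarrow> nat) \<Rightarrow> 'v \<Rightarrow> ('v \<Rightarrow> nat) pmf" where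
  "after_arrival G \<Phi> x i =
     (if candidates G x i = {} then return_pmf (x(i := x i + 1))
      else map_pmf (\<lambda>j. x(j := x j - 1)) (\<Phi> x i))"

text \<open>Class-\<open>i\<close> items arrive at the epochs of independent Poisson processes of intensity \<open>lam i\<close>,
  so that the transition rate to \<open>y\<close> adds up, over \<open>i\<close>, the rate \<open>lam i\<close> thinned by the
  probability that such an arrival leads to \<open>y\<close>.\<close>

definition queue_rate ::
    "'v pair_pre_digraph \<Rightarrow> ('v \<Rightarrow> real) \<Rightarrow> 'v policy \<Rightarrow> ('v \<Rightarrow> nat) \<Rightarrow> ('v \<Rightarrow> nat) \<Rightarrow> real" where
  "queue_rate G lam \<Phi> x y = (\<Sum>i\<in>pverts G. lam i * pmf (after_arrival G \<Phi> x i) y)"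

text \<open>Two adjacent classes are never queued at the same time; the states below are exactly those
  reachable from the empty queue.\<close>

definition queue_states :: "'v pair_pre_digraph \<Rightarrow> ('v \<Rightarrow> nat) set" where
  "queue_states G = {x. independent_set G {i. x i > 0}}"

definition stable :: "'v pair_pre_digraph \<Rightarrow> ('v \<Rightarrow> real) \<Rightarrow> 'v policy \<Rightarrow> bool" where
  "stable G lam \<Phi> \<longleftrightarrow> positive_recurrent (queue_states G) (queue_rate G lam \<Phi>)"

text \<open>A vector of intensities, indexed by the vertices, is an extensional function on them.\<close>

definition Ncond :: "'v pair_pre_digraph \<Rightarrow> ('v \<Rightarrow> real) set" where
  "Ncond G = {lam \<in> pverts G \<rightarrow>\<^sub>E {0<..}.
     \<forall>I. independent_set G I \<and> I \<noteq> {} \<longrightarrow> (\<Sum>i\<in>I. lam i) < (\<Sum>j\<in>nbrs G I. lam j)}"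

definition maximal :: "'v pair_pre_digraph \<Rightarrow> 'v policy \<Rightarrow> bool" where
  "maximal G \<Phi> \<longleftrightarrow> {lam \<in> pverts G \<rightarrow>\<^sub>E {0<..}. stable G lam \<Phi>} = Ncond G"

end

(*
  If Ncond G is non-empty, then G is not bipartite, so a shortest odd closed walk is an induced odd
  cycle. For G outside G7 this cycle is a triangle, or G induces a pendant graph or a 5-cycle. A
  connected pendant-free graph with a triangle is complete multipartite, because non-adjacency is
  then transitive; this is the required separability.

  If G induces a pendant graph or a 5-cycle H, the uniform policy is unstable for some intensities
  in Ncond G: those on H are explicit, the others tiny. A linear function f of the queue contents
  has nonnegative drift wherever it is positive and jumps by at most 1, so that excursions into
  {f > 0} have infinite mean length and the empty state is not positive recurrent.
*)

theory Submission
  imports Defs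
begin

section \<open>Induced cycles and pendant-free graphs\<close>

text \<open>Nothing is known about the classes outside \<open>H\<close>: they may be joined to
  \<open>H\<close> in any way, and however small their intensities, their queues can be long. The
  drift bound must therefore hold state by state, for one linear function, in every state where it
  is positive. It can, because the uniform choice ignores queue lengths. In both graphs one class,
  \<open>d\<close> in the pendant graph and \<open>a\<close> in the pentagon, has an intensity just
  below that of its neighbourhood in \<open>H\<close>, so it needs nearly all arrivals there; but a
  single queued item of a competing class leaves it at most half of the arrivals of one neighbour.
  The intensities on \<open>H\<close> keep a margin of 1/10 both in \<open>Ncond\<close> and in the
  drift, and the classes outside \<open>H\<close> are made rare enough to fit into both margins.
  Nonnegative drift by itself does not give transience; it gives an infinite mean return time, which
  is enough to refute stability.\<close>

lemma induces_iff:
  assumes "pair_wf_digraph G" "pair_wf_digraph H"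
  shows "induces G H \<longleftrightarrow> (\<exists>h. inj_on h (pverts H) \<and> h ` pverts H \<subseteq> pverts G \<and>
    (\<forall>i\<in>pverts H. \<forall>j\<in>pverts H. (h i, h j) \<in> parcs G \<longleftrightarrow> (i, j) \<in> parcs H))"
    (is "_ \<longleftrightarrow> (\<exists>h. ?emb h)")
proof
  assume "induces G H"
  then obtain K f where K: "induced_subgraph K (with_proj G)"
    and f: "pre_digraph.digraph_isomorphism K f" and app: "with_proj H = app_iso f K"
    by (auto simp: induces_def digraph_iso_def)
  let ?g = "iso_verts f"
  have tail: "tail K = fst" "head K = snd"
    and arcs_K: "arcs K = {a \<in> parcs G. fst a \<in> verts K \<and> snd a \<in> verts K}"
    and verts_K: "verts K \<subseteq> pverts G"
    using K by (auto simp: induced_subgraph_def subgraph_def compatible_def)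
  have verts_H: "pverts H = ?g ` verts K" and arcs_H: "parcs H = iso_arcs f ` arcs K"
    and fst_snd: "fst = iso_tail f" "snd = iso_head f"
    using arg_cong[OF app, of verts] arg_cong[OF app, of arcs]
      arg_cong[OF app, of tail] arg_cong[OF app, of head] by simp_all
  have inj: "inj_on ?g (verts K)"
    using f by (simp add: pre_digraph.digraph_isomorphism_def)
  \<comment> \<open>\<open>with_proj H\<close> has \<open>fst\<close> and \<open>snd\<close> as tail
    and head, so an arc goes to the pair of the images of its ends: the vertex map determines the
    arc map.\<close>
  have arc: "iso_arcs f a = (?g (fst a), ?g (snd a))" if "a \<in> arcs K" for a
    using f that unfolding pre_digraph.digraph_isomorphism_def tail fst_snd[symmetric]
    by (simp add: prod_eq_iff)
  \<comment> \<open>The isomorphism leads from \<open>K\<close> to \<open>H\<close>; the embedding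
    of \<open>H\<close> into \<open>G\<close> is its inverse.\<close>
  let ?h = "the_inv_into (verts K) ?g"
  have "(?h i, ?h j) \<in> parcs G \<longleftrightarrow> (i, j) \<in> parcs H" if ij: "i \<in> pverts H" "j \<in> pverts H" for i j
  proof -
    obtain u v where u: "u \<in> verts K" "i = ?g u" and v: "v \<in> verts K" "j = ?g v"
      using ij verts_H by auto
    have h: "?h i = u" "?h j = v"
      using u v inj by (simp_all add: the_inv_into_f_f)
    show ?thesis
    proof
      assume "(?h i, ?h j) \<in> parcs G"
      then have "(u, v) \<in> arcs K"
        using u v h by (simp add: arcs_K)
      then show "(i, j) \<in> parcs H"
        using arc[of "(u, v)"] u v unfolding arcs_H by force
    next
      assume "(i, j) \<in> parcs H"
      then obtain a where a: "a \<in> arcs K" "(i, j) = iso_arcs f a"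
        unfolding arcs_H by auto
      then have "?g (fst a) = ?g u" "?g (snd a) = ?g v" "fst a \<in> verts K" "snd a \<in> verts K"
        using arc[OF a(1)] u v by (auto simp: arcs_K)
      then have "a = (u, v)"
        using inj u v by (auto simp: prod_eq_iff dest: inj_onD)
      then show "(?h i, ?h j) \<in> parcs G"
        using a(1) h by (simp add: arcs_K)
    qed
  qed
  then have "?emb ?h"
    using inj verts_K
    by (auto simp: verts_H inj_on_the_inv_into the_inv_into_f_f)
  then show "\<exists>h. ?emb h"
    by (rule exI[where x = ?h])
next
  assume "\<exists>h. ?emb h"
  then obtain h where h: "inj_on h (pverts H)" "h ` pverts H \<subseteq> pverts G"
    "\<And>i j. i \<in> pverts H \<Longrightarrow> j \<in> pverts H \<Longrightarrow> (h i, h j) \<in> parcs G \<longleftrightarrow> (i, j) \<in> parcs H"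
    by auto
  let ?V = "h ` pverts H"
  let ?K = "\<lparr>pverts = ?V, parcs = {a \<in> parcs G. fst a \<in> ?V \<and> snd a \<in> ?V}\<rparr>"
  let ?g = "the_inv_into (pverts H) h"
  let ?f = "\<lparr>iso_verts = ?g, iso_arcs = map_prod ?g ?g, iso_head = snd, iso_tail = fst\<rparr>"
  have K: "pair_wf_digraph ?K"
    by unfold_locales auto
  have g_h: "?g (h i) = i" if "i \<in> pverts H" for i
    using h(1) that by (rule the_inv_into_f_f)
  have inj_g: "inj_on ?g ?V"
    using h(1) by (rule inj_on_the_inv_into)
  have "induced_subgraph (with_proj ?K) (with_proj G)"
    unfolding induced_subgraph_def subgraph_def
    using h(2) assms(1) K by (auto simp: wf_digraph_wp_iff)
  moreover have "pre_digraph.digraph_isomorphism (with_proj ?K) ?f"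
    unfolding pre_digraph.digraph_isomorphism_def using inj_g K
    by (auto simp: wf_digraph_wp_iff inj_on_def)
  moreover have "with_proj H = app_iso ?f (with_proj ?K)"
  proof (rule pre_digraph.equality)
    show "verts (with_proj H) = verts (app_iso ?f (with_proj ?K))"
      using h(1) by (simp add: the_inv_into_onto)
    have "parcs H = map_prod ?g ?g ` {a \<in> parcs G. fst a \<in> ?V \<and> snd a \<in> ?V}"
    proof (intro equalityI subsetI)
      fix a assume "a \<in> parcs H"
      then have a: "fst a \<in> pverts H" "snd a \<in> pverts H" "(fst a, snd a) \<in> parcs H"
        using pair_wf_digraph.arc_fst_in_verts[OF assms(2)] pair_wf_digraph.arc_snd_in_verts[OF assms(2)]
        by auto
      then have "(h (fst a), h (snd a)) \<in> parcs G"
        using h(3) by simp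
      then show "a \<in> map_prod ?g ?g ` {a \<in> parcs G. fst a \<in> ?V \<and> snd a \<in> ?V}"
        using a by (intro image_eqI[of _ _ "(h (fst a), h (snd a))"]) (simp_all add: g_h)
    next
      fix a assume "a \<in> map_prod ?g ?g ` {a \<in> parcs G. fst a \<in> ?V \<and> snd a \<in> ?V}"
      then obtain i j where "i \<in> pverts H" "j \<in> pverts H" "(h i, h j) \<in> parcs G" "a = (?g (h i), ?g (h j))"
        by auto
      then show "a \<in> parcs H"
        using h(3) by (simp add: g_h)
    qed
    then show "arcs (with_proj H) = arcs (app_iso ?f (with_proj ?K))"
      by simp
  qed simp_all
  ultimately show "induces G H"
    unfolding induces_def digraph_iso_def by blast
qed

section \<open>Parity of walks, shortest odd closed walks, and triangles without pendants\<close>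

context pair_graph
begin

lemma arc_sym: "(u, v) \<in> parcs G \<Longrightarrow> (v, u) \<in> parcs G"
  using sym_arcs by (auto simp: symmetric_def dest: symD)

lemma arcs_commute: "(u, v) \<in> parcs G \<longleftrightarrow> (v, u) \<in> parcs G"
  using arc_sym by blast

lemma loop_free: "(v, v) \<notin> parcs G"
  using pair_no_loops[of "(v, v)"] by auto

lemma connected_rtrancl:
  assumes "Digraph_Component.connected (with_proj G)" "u \<in> pverts G" "v \<in> pverts G"
  shows "(u, v) \<in> (parcs G)\<^sup>*"
proof -
  have "u \<rightarrow>\<^sup>*\<^bsub>with_proj (mk_symmetric (with_proj G))\<^esub> v"
    using assms by (auto simp: Digraph_Component.connected_def strongly_connected_def)
  then have "(u, v) \<in> (parcs (mk_symmetric (with_proj G)))\<^sup>*"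
    using reachable_rtranclI by fastforce
  also have "parcs (mk_symmetric (with_proj G)) = parcs G"
    using arc_sym by (force simp: parcs_mk_symmetric)
  finally show ?thesis .
qed

text \<open>All neighbours of one side lie in the other, so \<open>Ncond\<close> would make each
  side strictly heavier than the other. If one side is empty, the other would weigh less than
  0.\<close>

lemma bipartite_Ncond_empty:
  assumes "A \<union> B = pverts G" "A \<inter> B = {}" "pverts G \<noteq> {}"
    and "independent_set G A" "independent_set G B"
  shows "Ncond G = {}"
proof (rule ccontr)
  assume "Ncond G \<noteq> {}"
  then obtain lam where lam: "lam \<in> Ncond G" by auto
  have nonneg: "0 \<le> lam v" if "v \<in> pverts G" for v
    using lam that by (intro less_imp_le) (auto simp: Ncond_def)
  have lt: "sum lam I < sum lam (nbrs G I)" if "independent_set G I" "I \<noteq> {}" for I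
    using lam that by (auto simp: Ncond_def)
  have fin: "finite A" "finite B"
    using assms(1) pair_finite_verts by (metis finite_Un)+
  have "nbrs G A \<subseteq> B" "nbrs G B \<subseteq> A"
    using assms in_arcsD2 unfolding nbrs_def independent_set_def by blast+
  then have "sum lam (nbrs G A) \<le> sum lam B" "sum lam (nbrs G B) \<le> sum lam A"
    using fin assms(1) by (auto intro!: sum_mono2 nonneg)
  moreover have "0 \<le> sum lam A" "0 \<le> sum lam B"
    using assms(1) by (auto intro!: sum_nonneg nonneg)
  ultimately show False
    using lt[OF assms(4)] lt[OF assms(5)] assms(1,3) by (cases "A = {}"; cases "B = {}"; simp)
qed

lemma relpow_sym: "(u, v) \<in> parcs G ^^ n \<Longrightarrow> (v, u) \<in> parcs G ^^ n"
proof (induction n arbitrary: v)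
  case (Suc n)
  then obtain w where "(u, w) \<in> parcs G ^^ n" "(w, v) \<in> parcs G"
    by (auto elim: relpow_Suc_E)
  then show ?case
    by (intro relpow_Suc_I2[OF arc_sym] Suc.IH)
qed simp

text \<open>Without odd closed walks, the parity of the length of a walk from a fixed root depends
  only on its endpoint, and the two parities form a bipartition.\<close>

lemma odd_closed_walk:
  assumes conn: "\<And>u v. u \<in> pverts G \<Longrightarrow> v \<in> pverts G \<Longrightarrow> (u, v) \<in> (parcs G)\<^sup>*"
    and "pverts G \<noteq> {}" "Ncond G \<noteq> {}"
  shows "\<exists>n v. odd n \<and> (v, v) \<in> parcs G ^^ n"
proof (rule ccontr)
  assume no: "\<not> ?thesis"
  obtain r where r: "r \<in> pverts G"
    using assms(2) by auto
  define A where "A = {v\<in>pverts G. \<exists>n. even n \<and> (r, v) \<in> parcs G ^^ n}"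
  define B where "B = {v\<in>pverts G. \<exists>n. odd n \<and> (r, v) \<in> parcs G ^^ n}"
  \<comment> \<open>A walk from the root to \<open>u\<close>, on to \<open>v\<close> and back closes
    up. Taking \<open>k = 0\<close> separates the two parity classes, \<open>k = 1\<close> makes
    each of them independent.\<close>
  have parity: False if "(r, u) \<in> parcs G ^^ n" "(u, v) \<in> parcs G ^^ k" "(r, v) \<in> parcs G ^^ m"
    "odd (n + k + m)" for u v n k m
  proof -
    have "(r, r) \<in> parcs G ^^ (n + k + m)"
      using that(1,2) relpow_sym[OF that(3)] by (auto simp: relpow_add)
    with no that(4) show False by blast
  qed
  have "A \<union> B = pverts G"
  proof -
    have "\<exists>n. (r, v) \<in> parcs G ^^ n" if "v \<in> pverts G" for v
      using rtrancl_imp_relpow[OF conn[OF r that]] by blast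
    then show ?thesis
      unfolding A_def B_def by blast
  qed
  moreover have "A \<inter> B = {}"
    using parity[of _ _ _ 0] by (auto simp: A_def B_def)
  moreover have "independent_set G A" "independent_set G B"
    using parity[of _ _ _ 1] by (fastforce simp: A_def B_def independent_set_def)+
  ultimately show False
    using bipartite_Ncond_empty assms by blast
qed

text \<open>A chord or a repeated vertex cuts an odd closed walk into two closed walks, one of them
  odd, which contradicts minimality unless the chord is an edge of the cycle. Minimising over closed
  walks at all vertices yields the injectivity of the cycle by the same argument as the absence of
  chords.\<close>

lemma induced_odd_cycle:
  assumes "odd m" "(v, v) \<in> parcs G ^^ m"
  obtains n f where "odd n" "3 \<le> n" "inj_on f {..<n}" "f ` {..<n} \<subseteq> pverts G"
    "\<And>i j. i < n \<Longrightarrow> j < n \<Longrightarrow> (f i, f j) \<in> parcs G \<longleftrightarrow> (i, j) \<in> parcs (cycle_graph n)"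
proof -
  define n where "n = (LEAST n. odd n \<and> (\<exists>v. (v, v) \<in> parcs G ^^ n))"
  have "odd n \<and> (\<exists>v. (v, v) \<in> parcs G ^^ n)"
    unfolding n_def by (rule LeastI[of _ m]) (use assms in blast)
  then obtain u where n: "odd n" "(u, u) \<in> parcs G ^^ n" by blast
  have n_le: "n \<le> k" if "odd k" "(v, v) \<in> parcs G ^^ k" for k v
    unfolding n_def by (rule Least_le) (use that in blast)
  obtain f where f: "f 0 = u" "f n = u" "\<And>i. i < n \<Longrightarrow> (f i, f (Suc i)) \<in> parcs G"
    using n(2) by (auto simp: relpow_fun_conv)
  have "n \<noteq> 1"
    using n(2) loop_free by auto
  with n(1) have "3 \<le> n"
    by presburger
  have seg: "(f i, f j) \<in> parcs G ^^ (j - i)" if "i \<le> j" "j \<le> n" for i j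
    unfolding relpow_fun_conv
    by (rule exI[of _ "\<lambda>k. f (i + k)"]) (use that f(3) in auto)
  \<comment> \<open>The case \<open>k = 0\<close> is a repeated vertex, \<open>k = 1\<close> a
    chord. The two closed walks have lengths adding up to \<open>n + 2 * k\<close>, which is odd, so
    one of them is odd and has length at least \<open>n\<close>.\<close>
  have short: "k = 1 \<and> (j = Suc i \<or> i = 0 \<and> j = n - 1)"
    if ij: "i < j" "j < n" and k: "k \<le> 1" "(f i, f j) \<in> parcs G ^^ k" for i j k
  proof -
    have "(f i, f i) \<in> parcs G ^^ (j - i + k)"
      using seg[of i j] relpow_sym[OF k(2)] ij unfolding relpow_add by auto
    moreover have "(f j, f j) \<in> parcs G ^^ (n - j + i + k)"
    proof -
      have "(f j, f 0) \<in> parcs G ^^ (n - j)"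
        using seg[of j n] f(1,2) ij by simp
      moreover have "(f 0, f i) \<in> parcs G ^^ i"
        using seg[of 0 i] ij by simp
      ultimately show ?thesis
        using k(2) unfolding relpow_add by blast
    qed
    moreover have "odd (j - i + k) \<or> odd (n - j + i + k)"
    proof -
      have "(j - i + k) + (n - j + i + k) = n + 2 * k"
        using ij by simp
      then show ?thesis
        using n(1) by (metis even_add even_mult_iff even_numeral)
    qed
    ultimately have "n \<le> j - i + k \<or> n \<le> n - j + i + k"
      using n_le by blast
    then show ?thesis
      using ij k(1) by auto
  qed
  have next_arc: "(f 0, f (n - 1)) \<in> parcs G"
    using f(3)[of "n - 1"] f(1,2) \<open>3 \<le> n\<close> arc_sym by simp
  have chord: "(f i, f j) \<in> parcs G \<longleftrightarrow> j = Suc i \<or> i = 0 \<and> j = n - 1" if "i < j" "j < n" for i j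
    using short[OF that, of 1] f(3)[of i] next_arc that by auto
  have cyc: "(i, j) \<in> parcs (cycle_graph n) \<longleftrightarrow> j = Suc i \<or> i = 0 \<and> j = n - 1" if "i < j" "j < n" for i j
  proof -
    have "(i + 1) mod n = Suc i" "(j + 1) mod n = (if j = n - 1 then 0 else Suc j)"
      using that by auto
    then show ?thesis
      using that by (auto simp: cycle_graph_def)
  qed
  have cyc_sym: "(i, j) \<in> parcs (cycle_graph n) \<longleftrightarrow> (j, i) \<in> parcs (cycle_graph n)" for i j
    by (auto simp: cycle_graph_def)
  have cyc_loop: "(i, i) \<notin> parcs (cycle_graph n)" for i
  proof
    assume "(i, i) \<in> parcs (cycle_graph n)"
    then have "i < n" "i = (i + 1) mod n"
      by (auto simp: cycle_graph_def)
    then show False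
      using \<open>3 \<le> n\<close> by (cases "i + 1 = n") auto
  qed
  show ?thesis
  proof (rule that[of n f])
    show "inj_on f {..<n}"
      using short[of _ _ 0] by (intro linorder_inj_onI) auto
    show "f ` {..<n} \<subseteq> pverts G"
      using f(3) by (auto dest: in_arcsD1)
    show "(f i, f j) \<in> parcs G \<longleftrightarrow> (i, j) \<in> parcs (cycle_graph n)" if "i < n" "j < n" for i j
      using that chord[of i j] chord[of j i] cyc[of i j] cyc[of j i] cyc_sym[of i j] cyc_loop[of i]
        loop_free arcs_commute[of "f i" "f j"]
      by (cases i j rule: linorder_cases) auto
  qed (use n \<open>3 \<le> n\<close> in auto)
qed

text \<open>If a vertex lies in a triangle, so does every edge at it; by connectivity every edge
  then lies in a triangle. From this it follows that each edge dominates the graph: every other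
  vertex is adjacent to one of its ends. This is transitivity of non-adjacency, so the parts are the
  classes of non-adjacent vertices, and a triangle meets three of them.\<close>

lemma separable_if_pendant_free:
  assumes conn: "\<And>u v. u \<in> pverts G \<Longrightarrow> v \<in> pverts G \<Longrightarrow> (u, v) \<in> (parcs G)\<^sup>*"
    and pendant_free: "\<And>a b c d. (a, b) \<in> parcs G \<Longrightarrow> (a, c) \<in> parcs G \<Longrightarrow> (b, c) \<in> parcs G \<Longrightarrow>
      (c, d) \<in> parcs G \<Longrightarrow> d \<noteq> a \<Longrightarrow> d \<noteq> b \<Longrightarrow> (a, d) \<in> parcs G \<or> (b, d) \<in> parcs G"
    and triangle: "(p, q) \<in> parcs G" "(p, r) \<in> parcs G" "(q, r) \<in> parcs G"
  shows "\<exists>n\<ge>3. separable G n"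
proof -
  let ?E = "parcs G"
  have edge_triangle: "\<exists>w. (x, w) \<in> ?E \<and> (z, w) \<in> ?E"
    if "(x, a) \<in> ?E" "(x, b) \<in> ?E" "(a, b) \<in> ?E" "(x, z) \<in> ?E" for x z a b
  proof (cases "z = a \<or> z = b")
    case True
    then show ?thesis
      using that arc_sym by blast
  next
    case False
    then show ?thesis
      using pendant_free[of a b x z] that arc_sym by blast
  qed
  have in_triangle: "\<exists>a b. (x, a) \<in> ?E \<and> (x, b) \<in> ?E \<and> (a, b) \<in> ?E" if "x \<in> pverts G" for x
  proof -
    have "(p, x) \<in> ?E\<^sup>*"
      using triangle that by (intro conn) (auto dest: in_arcsD1)
    then show ?thesis
    proof induction
      case base
      then show ?case using triangle by blast
    next
      case (step y z)
      then obtain w where "(y, w) \<in> ?E" "(z, w) \<in> ?E"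
        using edge_triangle by blast
      then show ?case
        using step(2) arc_sym by blast
    qed
  qed
  have dist2: "y = x \<or> y = z \<or> (x, y) \<in> ?E \<or> (z, y) \<in> ?E"
    if xz: "(x, z) \<in> ?E" and xu: "(x, u) \<in> ?E" and uy: "(u, y) \<in> ?E" for x z u y
  proof (rule ccontr)
    assume no: "\<not> ?thesis"
    obtain a b where "(x, a) \<in> ?E" "(x, b) \<in> ?E" "(a, b) \<in> ?E"
      using in_triangle[OF in_arcsD1[OF xz]] by blast
    then obtain w where w: "(x, w) \<in> ?E" "(z, w) \<in> ?E"
      using edge_triangle xz by blast
    show False
    proof (cases "(z, u) \<in> ?E \<or> u = z")
      case True
      then show False
        using pendant_free[of x z u y] xz xu uy no by blast
    next
      case False
      \<comment> \<open>Three pendants in a row, with \<open>w\<close> completing a triangle on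
        \<open>x\<close>, \<open>z\<close>: \<open>u\<close> hanging at \<open>x\<close> from the
        triangle \<open>z w x\<close> forces the edge \<open>w u\<close>, then \<open>y\<close> at
        \<open>u\<close> from \<open>x w u\<close> forces \<open>w y\<close>, and \<open>y\<close>
        at \<open>w\<close> from \<open>x z w\<close> contradicts the choice of
        \<open>y\<close>.\<close>
      then have "u \<noteq> w" using w by blast
      then have "(w, u) \<in> ?E"
        using pendant_free[of z w x u] xz xu uy w False arc_sym by blast
      then have "(w, y) \<in> ?E"
        using pendant_free[of x w u y] xz xu uy w no by blast
      then show False
        using pendant_free[of x z w y] xz xu uy w no by blast
    qed
  qed
  have near: "y = x \<or> y = z \<or> (x, y) \<in> ?E \<or> (z, y) \<in> ?E" if xz: "(x, z) \<in> ?E" and y: "y \<in> pverts G" for x y z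
  proof -
    have "(x, y) \<in> ?E\<^sup>*"
      using xz y by (intro conn) (auto dest: in_arcsD1)
    then show ?thesis
    proof induction
      case (step u y)
      then show ?case
        using dist2[OF xz] dist2[OF arc_sym[OF xz]] by blast
    qed simp
  qed
  define N where "N = {(u, v). u \<in> pverts G \<and> v \<in> pverts G \<and> (u, v) \<notin> ?E}"
  have N: "equiv (pverts G) N"
  proof (rule equivI)
    show "N \<subseteq> pverts G \<times> pverts G" by (auto simp: N_def)
    show "refl_on (pverts G) N"
      using loop_free by (auto simp: N_def refl_on_def)
    show "sym N"
      using arc_sym by (auto simp: N_def sym_def)
    \<comment> \<open>If \<open>u\<close> and \<open>w\<close> were adjacent, a vertex adjacent to
      neither of them would violate \<open>near\<close>.\<close>
    show "trans N"
      using near arc_sym unfolding N_def trans_def by blast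
  qed
  let ?P = "pverts G // N"
  have "partition_on (pverts G) ?P"
    using N by (rule partition_on_quotient)
  moreover have "maximal_independent_set G I" if "I \<in> ?P" for I
  proof -
    obtain v where v: "v \<in> pverts G" "I = N `` {v}"
      using \<open>I \<in> ?P\<close> by (rule quotientE)
    have "independent_set G I"
      using \<open>I \<in> ?P\<close> quotient_eq_iff[OF N, of I I] in_quotient_imp_subset[OF N, of I]
      unfolding independent_set_def N_def by auto
    moreover have "J = I" if J: "independent_set G J" "I \<subseteq> J" for J
    proof (intro equalityI subsetI)
      fix u assume "u \<in> J"
      moreover have "v \<in> J"
        using J(2) v equiv_class_self[OF N v(1)] by blast
      ultimately show "u \<in> I"
        using J(1) unfolding v N_def independent_set_def by auto
    qed (use J in auto)
    ultimately show ?thesis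
      by (auto simp: maximal_independent_set_def)
  qed
  moreover have "(u, v) \<in> ?E" if "I \<in> ?P" "J \<in> ?P" "I \<noteq> J" "u \<in> I" "v \<in> J" for I J u v
  proof -
    have "(u, v) \<notin> N"
      using that quotient_eq_iff[OF N, of I J u v] by blast
    then show ?thesis
      using that in_quotient_imp_subset[OF N] unfolding N_def by blast
  qed
  moreover have "3 \<le> card ?P"
  proof -
    have V: "p \<in> pverts G" "q \<in> pverts G" "r \<in> pverts G"
      using triangle by (auto dest: in_arcsD1 in_arcsD2)
    have "N `` {p} \<noteq> N `` {q}" "N `` {p} \<noteq> N `` {r}" "N `` {q} \<noteq> N `` {r}"
      using V triangle eq_equiv_class_iff[OF N] by (auto simp: N_def)
    then have "card {N `` {p}, N `` {q}, N `` {r}} = 3"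
      by simp
    moreover have "finite ?P"
      using N pair_finite_verts by (intro finite_quotient) (auto simp: equiv_type)
    ultimately show ?thesis
      using V card_mono[of ?P "{N `` {p}, N `` {q}, N `` {r}}"] by (simp add: quotientI)
  qed
  ultimately show ?thesis
    unfolding separable_def by (intro exI[of _ "card ?P"] conjI exI[of _ ?P]) auto
qed

end

section \<open>A criterion against positive recurrence\<close>

lemma nn_integral_jump_chain_law_restrict:
  assumes [measurable]: "F \<in> borel_measurable (PiM {0..<m} (\<lambda>_. count_space UNIV))"
  shows "(\<integral>\<^sup>+Y. F (restrict Y {0..<m}) \<partial>jump_chain_law q x) =
    (\<integral>\<^sup>+Y. F Y \<partial>Ionescu_Tulcea.C (jump_kernel q x) (\<lambda>_. count_space UNIV) 0 m (\<lambda>_. undefined))"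
proof -
  interpret IT: Ionescu_Tulcea "jump_kernel q x" "\<lambda>_. count_space UNIV"
    by (rule Ionescu_Tulcea_jump_kernel)
  have up: "IT.up_to {0..<m} = m"
    unfolding IT.up_to_def by (rule Least_equality) (auto simp flip: not_less)
  have sets_C [measurable_cong]:
      "sets (IT.C 0 m (\<lambda>_. undefined)) = sets (PiM {0..<m} (\<lambda>_. count_space UNIV))"
    using IT.sets_C[of "\<lambda>_. undefined" 0 m] by simp
  have space_C: "space (IT.C 0 m (\<lambda>_. undefined)) = space (PiM {0..<m} (\<lambda>_. count_space UNIV))"
    using sets_eq_imp_space_eq[OF sets_C] .
  have "(\<integral>\<^sup>+Y. F (restrict Y {0..<m}) \<partial>jump_chain_law q x) =
      (\<integral>\<^sup>+Y. F Y \<partial>distr IT.PF.lim (PiM {0..<m} (\<lambda>_. count_space UNIV)) (\<lambda>Y. restrict Y {0..<m}))"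
    unfolding jump_chain_law_def
    by (subst nn_integral_distr) (auto simp: measurable_cong_sets[OF IT.PF.sets_lim refl] intro!: measurable_restrict_subset)
  also have "\<dots> = (\<integral>\<^sup>+Y. F Y \<partial>IT.CI {0..<m})"
    by (subst IT.distr_lim) auto
  also have "\<dots> = (\<integral>\<^sup>+Y. F (restrict Y {0..<m}) \<partial>IT.C 0 m (\<lambda>_. undefined))"
    unfolding IT.CI_def up by (subst nn_integral_distr) auto
  also have "\<dots> = (\<integral>\<^sup>+Y. F Y \<partial>IT.C 0 m (\<lambda>_. undefined))"
    by (intro nn_integral_cong) (auto simp: space_C space_PiM PiE_restrict)
  finally show ?thesis .
qed

lemma sets_jump_chain_law [measurable_cong]:
  "sets (jump_chain_law q x) = sets (PiM UNIV (\<lambda>_. count_space UNIV))"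
proof -
  interpret IT: Ionescu_Tulcea "jump_kernel q x" "\<lambda>_. count_space UNIV"
    by (rule Ionescu_Tulcea_jump_kernel)
  show ?thesis
    unfolding jump_chain_law_def by (rule IT.PF.sets_lim)
qed

lemma prob_space_jump_chain_law: "prob_space (jump_chain_law q x)"
proof -
  interpret IT: Ionescu_Tulcea "jump_kernel q x" "\<lambda>_. count_space UNIV"
    by (rule Ionescu_Tulcea_jump_kernel)
  have "emeasure (jump_chain_law q x) (space (jump_chain_law q x)) = (\<integral>\<^sup>+Y. 1 \<partial>jump_chain_law q x)"
    by simp
  also have "\<dots> = 1"
    using nn_integral_jump_chain_law_restrict[of "\<lambda>_. 1" 0 q x]
      prob_space.emeasure_space_1[OF IT.prob_space_C[of "\<lambda>_. undefined" 0 0]]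
    by (simp add: space_PiM del: IT.C.simps)
  finally show ?thesis
    by (rule prob_spaceI)
qed

lemma nn_integral_jump_chain_law_0:
  "(\<integral>\<^sup>+Y. g (Y 0) \<partial>jump_chain_law q x) = g x"
proof -
  interpret IT: Ionescu_Tulcea "jump_kernel q x" "\<lambda>_. count_space UNIV"
    by (rule Ionescu_Tulcea_jump_kernel)
  have m: "(\<lambda>Y. g (Y 0)) \<in> borel_measurable (PiM {0..<Suc 0} (\<lambda>_. count_space UNIV))"
    by (rule measurable_compose[of "\<lambda>Y. Y 0" _ "count_space UNIV"])
      (auto intro!: measurable_component_singleton)
  have "(\<integral>\<^sup>+Y. g (Y 0) \<partial>jump_chain_law q x) = (\<integral>\<^sup>+Y. g (Y 0) \<partial>IT.C 0 (Suc 0) (\<lambda>_. undefined))"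
    using nn_integral_jump_chain_law_restrict[OF m, of q x] by simp
  also have "\<dots> = (\<integral>\<^sup>+Y. g (Y 0) \<partial>IT.eP 0 (\<lambda>_. undefined))"
    unfolding IT.C.simps add_0 by (subst bind_return[OF IT.measurable_eP]) (simp_all add: space_PiM)
  also have "\<dots> = (\<integral>\<^sup>+y. g y \<partial>jump_kernel q x 0 (\<lambda>_. undefined))"
    using IT.nn_integral_eP[OF _ m, of "\<lambda>_. undefined"] by (simp add: space_PiM)
  also have "\<dots> = g x"
    by (simp add: jump_kernel_def)
  finally show ?thesis .
qed

text \<open>The Markov property for one step, with \<open>h\<close> as an arbitrary weight on the
  past. As an identity of integrals in \<open>ennreal\<close> it involves no conditional expectation
  and no integrability.\<close>

lemma nn_integral_jump_chain_law_Suc: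
  assumes [measurable]: "h \<in> borel_measurable (PiM {0..<Suc n} (\<lambda>_. count_space UNIV))"
  shows "(\<integral>\<^sup>+Y. h (restrict Y {0..<Suc n}) * g (Y (Suc n)) \<partial>jump_chain_law q x) =
    (\<integral>\<^sup>+Y. h (restrict Y {0..<Suc n}) * (\<integral>\<^sup>+y. g y \<partial>jump_pmf q (Y n)) \<partial>jump_chain_law q x)"
proof -
  interpret IT: Ionescu_Tulcea "jump_kernel q x" "\<lambda>_. count_space UNIV"
    by (rule Ionescu_Tulcea_jump_kernel)
  let ?P = "\<lambda>m. PiM {0..<m} (\<lambda>_. count_space UNIV) :: (nat \<Rightarrow> 'a) measure"
  let ?C = "\<lambda>m. IT.C 0 m (\<lambda>_. undefined)"
  have coord: "(\<lambda>Y. k (Y i)) \<in> borel_measurable (?P m)" if "i < m" for i m and k :: "'a \<Rightarrow> ennreal"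
    by (rule measurable_compose[of "\<lambda>Y. Y i" _ "count_space UNIV"])
      (use that in \<open>auto intro!: measurable_component_singleton\<close>)
  have [measurable]: "(\<lambda>Y. restrict Y {0..<Suc n}) \<in> measurable (?P (Suc (Suc n))) (?P (Suc n))"
    by (rule measurable_restrict_subset) auto
  have F [measurable]: "(\<lambda>Y. h (restrict Y {0..<Suc n}) * g (Y (Suc n))) \<in> borel_measurable (?P (Suc (Suc n)))"
    using coord[of "Suc n" "Suc (Suc n)" g] by measurable
  have sets_C: "sets (?C m) = sets (?P m)" for m
    using IT.sets_C[of "\<lambda>_. undefined" 0 m] by simp
  have space_C: "space (?C m) = space (?P m)" for m
    using sets_eq_imp_space_eq[OF sets_C] .
  have "(\<integral>\<^sup>+Y. h (restrict Y {0..<Suc n}) * g (Y (Suc n)) \<partial>jump_chain_law q x) =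
      (\<integral>\<^sup>+Y. (\<lambda>Y. h (restrict Y {0..<Suc n}) * g (Y (Suc n))) (restrict Y {0..<Suc (Suc n)}) \<partial>jump_chain_law q x)"
    by (simp add: inf.absorb2)
  also have "\<dots> = (\<integral>\<^sup>+Y. h (restrict Y {0..<Suc n}) * g (Y (Suc n)) \<partial>?C (Suc (Suc n)))"
    by (rule nn_integral_jump_chain_law_restrict) (rule F)
  also have "\<dots> = (\<integral>\<^sup>+Z. (\<integral>\<^sup>+Y. h (restrict Y {0..<Suc n}) * g (Y (Suc n)) \<partial>IT.eP (Suc n) Z) \<partial>?C (Suc n))"
    unfolding IT.C.simps(2)[of 0 "Suc n"] add_0
    by (rule nn_integral_bind[where B="?P (Suc (Suc n))"])
      (simp_all add: F IT.measurable_eP measurable_cong_sets[OF sets_C refl] del: IT.C.simps)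
  also have "\<dots> = (\<integral>\<^sup>+Z. h Z * (\<integral>\<^sup>+y. g y \<partial>jump_pmf q (Z n)) \<partial>?C (Suc n))"
  proof (rule nn_integral_cong)
    fix Z assume "Z \<in> space (?C (Suc n))"
    then have Z: "Z \<in> space (?P (Suc n))"
      by (simp only: space_C)
    then have r: "restrict (Z(Suc n := y)) {0..<Suc n} = Z" for y
      by (auto simp: space_PiM PiE_iff extensional_def restrict_def fun_eq_iff)
    have "(\<integral>\<^sup>+Y. h (restrict Y {0..<Suc n}) * g (Y (Suc n)) \<partial>IT.eP (Suc n) Z) =
        (\<integral>\<^sup>+y. h Z * g y \<partial>jump_kernel q x (Suc n) Z)"
      by (subst IT.nn_integral_eP[OF Z]) (simp_all add: r F)
    also have "\<dots> = h Z * (\<integral>\<^sup>+y. g y \<partial>jump_pmf q (Z n))"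
      by (simp add: jump_kernel_def nn_integral_cmult)
    finally show "(\<integral>\<^sup>+Y. h (restrict Y {0..<Suc n}) * g (Y (Suc n)) \<partial>IT.eP (Suc n) Z) = \<dots>" .
  qed
  also have "\<dots> = (\<integral>\<^sup>+Y. (\<lambda>Z. h Z * (\<integral>\<^sup>+y. g y \<partial>jump_pmf q (Z n))) (restrict Y {0..<Suc n}) \<partial>jump_chain_law q x)"
    by (rule nn_integral_jump_chain_law_restrict[symmetric])
      (use coord[of n "Suc n" "\<lambda>z. \<integral>\<^sup>+y. g y \<partial>jump_pmf q z"] in measurable)
  also have "\<dots> = (\<integral>\<^sup>+Y. h (restrict Y {0..<Suc n}) * (\<integral>\<^sup>+y. g y \<partial>jump_pmf q (Y n)) \<partial>jump_chain_law q x)"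
    by simp
  finally show ?thesis .
qed

section \<open>Exponential holding times\<close>

lemma nn_integral_holding_times:
  fixes c :: real
  shows "(\<integral>\<^sup>+E. ennreal (E k / c) \<partial>PiM UNIV (\<lambda>_ :: nat. density lborel (exponential_density 1))) =
    (\<integral>\<^sup>+e. ennreal (e / c) \<partial>density lborel (exponential_density 1))"
proof -
  interpret P: product_prob_space "\<lambda>_ :: nat. density lborel (exponential_density 1)" UNIV
    by (rule product_prob_spaceI) (simp add: prob_space_exponential_density)
  show ?thesis
    by (subst P.PiM_component[symmetric, of k]) (simp_all add: nn_integral_distr)
qed

lemma AE_exponential_pos: "AE e in density lborel (exponential_density 1). 0 < (e :: real)"
proof -
  have "AE e in lborel. e \<noteq> (0 :: real)"
    by (rule AE_lborel_singleton)
  then show ?thesis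
    by (subst AE_density) (auto simp: exponential_density_def elim!: eventually_mono)
qed

text \<open>In the criterion below the mean holding time multiplies a divergent series, so its
  positivity decides; it holds because an exponential variable is almost surely positive.\<close>

lemma nn_integral_exponential_pos:
  assumes "0 < (c :: real)"
  shows "0 < (\<integral>\<^sup>+e. ennreal (e / c) \<partial>density lborel (exponential_density 1))"
proof (rule ccontr)
  assume "\<not> ?thesis"
  then have "AE e in density lborel (exponential_density 1). ennreal (e / c) = 0"
    by (simp add: nn_integral_0_iff_AE)
  with AE_exponential_pos have "AE e in density lborel (exponential_density 1). False"
    by eventually_elim (use assms in \<open>auto simp: ennreal_eq_0_iff field_simps\<close>)
  moreover have "prob_space (density lborel (exponential_density 1) :: real measure)"
    by (rule prob_space_exponential_density) simp
  ultimately show False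
    using prob_space.AE_False by blast
qed

lemma AE_holding_times_pos:
  "AE E in PiM UNIV (\<lambda>_ :: nat. density lborel (exponential_density 1)). \<forall>k. 0 < (E k :: real)"
proof -
  interpret P: product_prob_space "\<lambda>_ :: nat. density lborel (exponential_density 1)" UNIV
    by (rule product_prob_spaceI) (simp add: prob_space_exponential_density)
  have "AE E in PiM UNIV (\<lambda>_ :: nat. density lborel (exponential_density 1)). 0 < (E k :: real)" for k
  proof (rule AE_distrD[where M' = "density lborel (exponential_density 1)" and f = "\<lambda>E. E k"])
    show "AE e in distr (PiM UNIV (\<lambda>_. density lborel (exponential_density 1)))
        (density lborel (exponential_density 1)) (\<lambda>E. E k). 0 < e"
      using AE_exponential_pos by (subst P.PiM_component) simp_all
  qed simp
  then show ?thesis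
    by (simp add: AE_all_countable)
qed

lemma prob_space_holding_times:
  "prob_space (PiM UNIV (\<lambda>_ :: nat. density lborel (exponential_density 1) :: real measure))"
  by (rule prob_space_PiM) (simp add: prob_space_exponential_density)

lemma nn_integral_pair_mult:
  assumes "sigma_finite_measure N"
    and [measurable]: "u \<in> borel_measurable M" "v \<in> borel_measurable N"
  shows "(\<integral>\<^sup>+\<omega>. u (fst \<omega>) * v (snd \<omega>) \<partial>(M \<Otimes>\<^sub>M N)) = (\<integral>\<^sup>+x. u x \<partial>M) * (\<integral>\<^sup>+y. v y \<partial>N)"
proof -
  interpret N: sigma_finite_measure N by fact
  have "(\<integral>\<^sup>+\<omega>. u (fst \<omega>) * v (snd \<omega>) \<partial>(M \<Otimes>\<^sub>M N)) = (\<integral>\<^sup>+x. (\<integral>\<^sup>+y. u x * v y \<partial>N) \<partial>M)"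
    by (subst N.nn_integral_fst[symmetric]) simp_all
  also have "\<dots> = (\<integral>\<^sup>+x. u x * (\<integral>\<^sup>+y. v y \<partial>N) \<partial>M)"
    by (simp add: nn_integral_cmult)
  also have "\<dots> = (\<integral>\<^sup>+x. u x \<partial>M) * (\<integral>\<^sup>+y. v y \<partial>N)"
    by (simp add: nn_integral_multc)
  finally show ?thesis .
qed

text \<open>Comparison with \<open>c\<close> times the harmonic series. The bound is stated as a
  product, so that no division takes place in \<open>ennreal\<close>; an infinite \<open>c\<close>
  makes \<open>b 1\<close> infinite.\<close>

lemma suminf_ennreal_ge_harmonic:
  fixes b :: "nat \<Rightarrow> ennreal"
  assumes "0 < c" and "\<And>k. k > 0 \<Longrightarrow> c \<le> of_nat k * b k"
  shows "(\<Sum>k. b k) = \<infinity>"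
proof (cases "c = \<infinity>")
  case True
  then have "b 1 = \<infinity>"
    using assms(2)[of 1] by (simp add: top_unique)
  then show ?thesis
    using sum_le_suminf[of b "{1}"] by (simp add: top_unique)
next
  case False
  then obtain r where r: "c = ennreal r" "r > 0"
    using assms(1) by (cases c) auto
  have "ennreal (r * inverse (real (Suc k))) \<le> b (Suc k)" for k
  proof (cases "b (Suc k)")
    case (real s)
    have "ennreal r \<le> ennreal (real (Suc k) * s)"
      using assms(2)[of "Suc k"] real r by (simp add: ennreal_mult ennreal_of_nat_eq_real_of_nat del: of_nat_Suc)
    then have "r \<le> real (Suc k) * s"
      using real by (subst (asm) ennreal_le_iff) auto
    then show ?thesis
      using real by (simp add: field_simps ennreal_leI)
  qed simp
  then have "(\<Sum>k. ennreal (r * inverse (real (Suc k)))) \<le> (\<Sum>k. b (Suc k))"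
    by (intro suminf_le) auto
  also have "\<dots> \<le> (\<Sum>k. b k)"
    by (subst (2) suminf_offset[of _ 1]) auto
  finally have le: "(\<Sum>k. ennreal (r * inverse (real (Suc k)))) \<le> (\<Sum>k. b k)" .
  have "\<not> summable (\<lambda>k. r * inverse (real (Suc k)))"
    using not_summable_harmonic[where 'a = real] r
      summable_Suc_iff[of "\<lambda>n. inverse (real n)"]
    unfolding summable_cmult_iff by blast
  then have "(\<Sum>k. ennreal (r * inverse (real (Suc k)))) = \<infinity>"
    using summable_suminf_not_top[of "\<lambda>k. r * inverse (real (Suc k))"] r(2)
    unfolding infinity_ennreal_def by fastforce
  with le show ?thesis
    by (simp add: top_unique)
qed

text \<open>Let \<open>u k\<close> be the expectation of \<open>f (Y k)\<close> on the event that \<open>Y 1, \<dots>, Y k\<close> lie in \<open>B\<close>, an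
  event of probability \<open>b k\<close>. The drift condition makes \<open>u\<close> nondecreasing, and \<open>f (Y k) \<le> k\<close>, so
  \<open>b k \<ge> u 1 / k\<close>. Hence the expected length of an excursion into \<open>B\<close> is at least a multiple of the
  harmonic series. The sets \<open>Bn k\<close> in the proof build the bound \<open>f (Y k) \<le> k\<close> into the event.\<close>

lemma not_positive_recurrent_stateI:
  fixes q :: "'s \<Rightarrow> 's \<Rightarrow> real" and f :: "'s \<Rightarrow> real"
  assumes rate: "\<And>x. exit_rate q x = c" "0 < c"
    and "x0 \<notin> B"
    and pos: "\<And>x. x \<in> B \<Longrightarrow> 0 < f x"
    and drift: "\<And>x. x \<in> B \<Longrightarrow> ennreal (f x) \<le> (\<integral>\<^sup>+y. ennreal (f y) * indicator B y \<partial>jump_pmf q x)"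
    and jump: "\<And>x y. x \<in> B \<Longrightarrow> y \<in> set_pmf (jump_pmf q x) \<Longrightarrow> f y \<le> f x + 1"
    and jump0: "\<And>y. y \<in> set_pmf (jump_pmf q x0) \<Longrightarrow> f y \<le> 1"
    and start: "y0 \<in> B" "y0 \<in> set_pmf (jump_pmf q x0)"
  shows "\<not> positive_recurrent_state q x0"
proof -
  define Bn where "Bn n = {x\<in>B. f x \<le> real n}" for n
  \<comment> \<open>The product starts at 1, because \<open>Y 0\<close> is \<open>x0\<close>, which
    lies outside \<open>B\<close>. Hence \<open>h 0\<close> is 1, and the monotonicity of
    \<open>u\<close> is proved from index 1 on.\<close>
  define h where "h k Y = (\<Prod>j\<in>{1..k}. indicator (Bn j) (Y j) :: ennreal)" for k and Y :: "nat \<Rightarrow> 's"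
  let ?L = "jump_chain_law q x0"
  define u where "u k = (\<integral>\<^sup>+Y. h k Y * ennreal (f (Y k)) \<partial>?L)" for k
  define b where "b k = (\<integral>\<^sup>+Y. h k Y \<partial>?L)" for k
  define g where "g k y = ennreal (f y) * indicator (Bn k) y" for k y
  have coord: "(\<lambda>Y. G (Y i)) \<in> borel_measurable (PiM I (\<lambda>_. count_space UNIV))" if "i \<in> I"
    for I :: "nat set" and i and G :: "'s \<Rightarrow> ennreal"
    by (rule measurable_compose[of "\<lambda>Y. Y i" _ "count_space UNIV"])
      (use that in \<open>auto intro!: measurable_component_singleton\<close>)
  have h_meas: "h k \<in> borel_measurable (PiM {0..<Suc k} (\<lambda>_. count_space UNIV))" for k
    unfolding h_def by (intro borel_measurable_prod_ennreal coord) auto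
  have h_meas' [measurable]: "h k \<in> borel_measurable ?L" for k
    unfolding h_def measurable_cong_sets[OF sets_jump_chain_law refl]
    by (intro borel_measurable_prod_ennreal coord) auto
  have h_restrict: "h k (restrict Y {0..<Suc k}) = h k Y" for k Y
    unfolding h_def by (intro prod.cong) auto
  have h_Suc: "h (Suc k) Y = h k Y * indicator (Bn (Suc k)) (Y (Suc k))" for k Y
    unfolding h_def by (simp add: mult.commute)
  have step: "(\<integral>\<^sup>+Y. h k Y * G (Y (Suc k)) \<partial>?L) = (\<integral>\<^sup>+Y. h k Y * (\<integral>\<^sup>+y. G y \<partial>jump_pmf q (Y k)) \<partial>?L)"
    for k G
    using nn_integral_jump_chain_law_Suc[OF h_meas, where n = k and g = G and q = q and x = x0] by (simp only: h_restrict)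
  have u_Suc: "u (Suc k) = (\<integral>\<^sup>+Y. h k Y * (\<integral>\<^sup>+y. g (Suc k) y \<partial>jump_pmf q (Y k)) \<partial>?L)" for k
    unfolding step[symmetric] u_def h_Suc g_def by (intro nn_integral_cong) (simp add: ac_simps)
  have mono: "u k \<le> u (Suc k)" if "k > 0" for k
    unfolding u_Suc unfolding u_def
  proof (intro nn_integral_mono)
    fix Y
    show "h k Y * ennreal (f (Y k)) \<le> h k Y * (\<integral>\<^sup>+y. g (Suc k) y \<partial>jump_pmf q (Y k))"
    proof (cases "Y k \<in> Bn k")
      case True
      then have Y: "Y k \<in> B" "f (Y k) \<le> real k"
        by (auto simp: Bn_def)
      have "ennreal (f (Y k)) \<le> (\<integral>\<^sup>+y. ennreal (f y) * indicator B y \<partial>jump_pmf q (Y k))"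
        by (rule drift) (rule Y)
      \<comment> \<open>A jump raises \<open>f\<close> by at most 1, so from a state of
        \<open>Bn k\<close> every successor in \<open>B\<close> lies in \<open>Bn (Suc k)\<close>,
        and both indicators agree on the support.\<close>
      also have "\<dots> = (\<integral>\<^sup>+y. g (Suc k) y \<partial>jump_pmf q (Y k))"
        by (intro nn_integral_cong_AE AE_pmfI)
          (use jump[OF Y(1)] Y(2) in \<open>force simp: g_def Bn_def split: split_indicator\<close>)
      finally show ?thesis
        by (rule mult_left_mono) simp
    next
      case False
      then have "h k Y = 0"
        using that unfolding h_def by (intro prod_zero bexI[of _ k]) auto
      then show ?thesis by simp
    qed
  qed
  have "u 1 = (\<integral>\<^sup>+y. g 1 y \<partial>jump_pmf q x0)"
    using u_Suc[of 0] nn_integral_jump_chain_law_0[where g = "\<lambda>x. \<integral>\<^sup>+y. g 1 y \<partial>jump_pmf q x" and q = q and x = x0]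
    by (simp add: h_def)
  also have "\<dots> \<noteq> 0"
  proof
    assume "(\<integral>\<^sup>+y. g 1 y \<partial>jump_pmf q x0) = 0"
    then have "g 1 y0 = 0"
      using start(2) by (simp add: nn_integral_0_iff_AE AE_measure_pmf_iff)
    moreover have "y0 \<in> Bn 1" "f y0 > 0"
      using start jump0 pos by (auto simp: Bn_def)
    ultimately show False
      by (simp add: g_def ennreal_eq_0_iff)
  qed
  finally have "0 < u 1"
    by (simp add: zero_less_iff_neq_zero)
  moreover have "u 1 \<le> of_nat k * b k" if "k > 0" for k
  proof -
    have "u 1 \<le> u k"
      using that by (induction rule: nat_induct_non_zero) (auto intro: order_trans mono)
    also have "\<dots> \<le> (\<integral>\<^sup>+Y. of_nat k * h k Y \<partial>?L)"
      unfolding u_def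
    proof (intro nn_integral_mono)
      fix Y
      show "h k Y * ennreal (f (Y k)) \<le> of_nat k * h k Y"
      proof (cases "Y k \<in> Bn k")
        case True
        then have "ennreal (f (Y k)) \<le> of_nat k"
          by (simp add: Bn_def ennreal_leI ennreal_of_nat_eq_real_of_nat)
        then show ?thesis
          by (subst mult.commute) (rule mult_right_mono, simp_all)
      next
        case False
        then have "h k Y = 0"
          using that unfolding h_def by (intro prod_zero bexI[of _ k]) auto
        then show ?thesis by simp
      qed
    qed
    also have "\<dots> = of_nat k * b k"
      by (simp add: b_def nn_integral_cmult)
    finally show ?thesis .
  qed
  ultimately have b_infty: "(\<Sum>k. b k) = \<infinity>"
    by (rule suminf_ennreal_ge_harmonic)

  let ?E = "PiM UNIV (\<lambda>_ :: nat. density lborel (exponential_density 1)) :: (nat \<Rightarrow> real) measure"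
  interpret L: prob_space ?L by (rule prob_space_jump_chain_law)
  interpret E: prob_space ?E by (rule prob_space_holding_times)
  interpret LE: pair_sigma_finite ?L ?E ..
  \<comment> \<open>The holding time in \<open>x0\<close> plus those of the states visited for as
    long as each \<open>Y j\<close>, from \<open>j = 1\<close> on, stays in \<open>Bn j\<close>. A
    return to \<open>x0\<close> cannot occur earlier.\<close>
  define R where "R \<omega> = (\<Sum>k. h k (fst \<omega>) * ennreal (snd \<omega> k / c))" for \<omega>
  define m where "m = (\<integral>\<^sup>+e. ennreal (e / c) \<partial>density lborel (exponential_density 1))"
  have m: "0 < m"
    unfolding m_def by (rule nn_integral_exponential_pos) (rule rate)
  have comp [measurable]: "(\<lambda>E. E k) \<in> borel_measurable ?E" for k
    using measurable_component_singleton[of k UNIV "\<lambda>_. density lborel (exponential_density 1) :: real measure"]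
    by simp
  have "AE \<omega> in ?L \<Otimes>\<^sub>M ?E. \<forall>k. 0 < snd \<omega> k"
  proof (rule LE.AE_pair_measure)
    show "{\<omega> \<in> space (?L \<Otimes>\<^sub>M ?E). \<forall>k. 0 < snd \<omega> k} \<in> sets (?L \<Otimes>\<^sub>M ?E)"
      by measurable
    show "AE Y in ?L. AE E in ?E. \<forall>k. 0 < snd (Y, E) k"
      using AE_holding_times_pos by simp
  qed
  then have "AE \<omega> in path_law q x0. R \<omega> \<le> return_time q x0 \<omega>"
    unfolding path_law_def
  proof eventually_elim
    fix \<omega> :: "(nat \<Rightarrow> 's) \<times> (nat \<Rightarrow> real)"
    assume E: "\<forall>k. 0 < snd \<omega> k"
    have "R \<omega> \<le> ennreal t"
      if t: "jump_time q \<omega> 1 \<le> t" "jump_time q \<omega> n \<le> t" "t < jump_time q \<omega> (Suc n)" "fst \<omega> n = x0"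
      for t n
    proof -
      \<comment> \<open>The interval with index 0 ends at the first jump, which the return time does
        not precede. So \<open>n\<close> is at least 1, and the factor with index \<open>n\<close>
        kills every later term of \<open>R\<close>.\<close>
      have "n \<noteq> 0"
        using t(1,3) by (intro notI) simp
      have "h k (fst \<omega>) = 0" if "k \<notin> {..<n}" for k
        using that \<open>n \<noteq> 0\<close> t(4) \<open>x0 \<notin> B\<close> unfolding h_def
        by (intro prod_zero) (auto intro!: bexI[of _ n] simp: Bn_def)
      then have "R \<omega> = (\<Sum>k<n. h k (fst \<omega>) * ennreal (snd \<omega> k / c))"
        unfolding R_def by (intro suminf_finite) auto
      also have "\<dots> \<le> (\<Sum>k<n. ennreal (snd \<omega> k / c))"
      proof (intro sum_mono)
        fix k
        have "h k (fst \<omega>) \<le> 1"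
          unfolding h_def by (intro prod_le_1) (auto split: split_indicator)
        then show "h k (fst \<omega>) * ennreal (snd \<omega> k / c) \<le> ennreal (snd \<omega> k / c)"
          using mult_right_mono[of "h k (fst \<omega>)" 1 "ennreal (snd \<omega> k / c)"] by simp
      qed
      also have "\<dots> = ennreal (jump_time q \<omega> n)"
        unfolding jump_time_def rate(1)
        by (rule sum_ennreal) (use E rate in \<open>auto intro!: divide_nonneg_nonneg less_imp_le\<close>)
      also have "\<dots> \<le> ennreal t"
        by (rule ennreal_leI) (rule t)
      finally show ?thesis .
    qed
    then show "R \<omega> \<le> return_time q x0 \<omega>"
      unfolding return_time_def by (intro Inf_greatest) auto
  qed
  then have "(\<integral>\<^sup>+\<omega>. R \<omega> \<partial>path_law q x0) \<le> (\<integral>\<^sup>+\<omega>. return_time q x0 \<omega> \<partial>path_law q x0)"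
    by (rule nn_integral_mono_AE)
  moreover have "(\<integral>\<^sup>+\<omega>. R \<omega> \<partial>path_law q x0) = \<infinity>"
  proof -
    have "(\<integral>\<^sup>+\<omega>. R \<omega> \<partial>path_law q x0) = (\<Sum>k. \<integral>\<^sup>+\<omega>. h k (fst \<omega>) * ennreal (snd \<omega> k / c) \<partial>(?L \<Otimes>\<^sub>M ?E))"
      unfolding R_def path_law_def by (rule nn_integral_suminf) measurable
    \<comment> \<open>The exit rate is \<open>c\<close> in every state, so the holding times are
      independent of the jump chain and each term factors.\<close>
    also have "\<dots> = (\<Sum>k. b k * m)"
    proof (rule arg_cong[where f = suminf], rule ext)
      fix k
      show "(\<integral>\<^sup>+\<omega>. h k (fst \<omega>) * ennreal (snd \<omega> k / c) \<partial>(?L \<Otimes>\<^sub>M ?E)) = b k * m"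
        using nn_integral_pair_mult[of ?E "h k" ?L "\<lambda>E. ennreal (E k / c)"]
        by (simp add: nn_integral_holding_times b_def m_def E.sigma_finite_measure_axioms)
    qed
    also have "\<dots> = (\<Sum>k. b k) * m"
      by (rule ennreal_suminf_multc)
    finally show ?thesis
      using b_infty m by (simp add: ennreal_top_mult)
  qed
  ultimately show ?thesis
    using rate by (simp add: positive_recurrent_state_def top_unique)
qed

section \<open>Linear functions of the queue under the uniform policy\<close>

definition queue_value :: "'v pair_pre_digraph \<Rightarrow> ('v \<Rightarrow> real) \<Rightarrow> ('v \<Rightarrow> nat) \<Rightarrow> real" where
  "queue_value G w x = (\<Sum>v\<in>pverts G. w v * real (x v))"

definition arrival_drift ::
    "'v pair_pre_digraph \<Rightarrow> ('v \<Rightarrow> real) \<Rightarrow> ('v \<Rightarrow> nat) \<Rightarrow> 'v \<Rightarrow> real" where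
  "arrival_drift G w x i = (if candidates G x i = {} then w i
     else - (\<Sum>j\<in>candidates G x i. w j) / real (card (candidates G x i)))"

text \<open>The total intensity is the same in all states and every arrival changes the state. Hence
  this law, of the state after the arrival of one item of a random class, is the one-step law of the
  jump chain.\<close>

definition arrival_step ::
    "'v pair_pre_digraph \<Rightarrow> ('v \<Rightarrow> real) \<Rightarrow> ('v \<Rightarrow> nat) \<Rightarrow> ('v \<Rightarrow> nat) pmf" where
  "arrival_step G lam x =
     bind_pmf (embed_pmf (\<lambda>i. if i \<in> pverts G then lam i / sum lam (pverts G) else 0))
       (after_arrival G (uniform_policy G) x)"

section \<open>Effect of a single arrival\<close>

context pair_graph
begin

lemma nbrs_subset: "nbrs G A \<subseteq> pverts G"
  by (auto simp: nbrs_def dest: in_arcsD2)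

lemma candidates_subset: "candidates G x i \<subseteq> pverts G"
  using nbrs_subset by (auto simp: candidates_def)

lemma finite_candidates [simp]: "finite (candidates G x i)"
  using finite_subset[OF candidates_subset] pair_finite_verts by blast

lemma mem_candidates: "j \<in> candidates G x i \<longleftrightarrow> (i, j) \<in> parcs G \<and> 0 < x j"
  by (auto simp: candidates_def nbrs_def)

lemma set_after_arrival:
  "set_pmf (after_arrival G (uniform_policy G) x i) =
    (if candidates G x i = {} then {x(i := x i + 1)}
     else (\<lambda>j. x(j := x j - 1)) ` candidates G x i)"
  by (simp add: after_arrival_def uniform_policy_def)

lemma finite_set_after_arrival: "finite (set_pmf (after_arrival G (uniform_policy G) x i))"
  by (simp add: set_after_arrival)

text \<open>An arrival either adds an item or removes a queued one. The absence of self-loops makes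
  the exit rate equal to the total intensity in every state, which gives the constant rate demanded
  by the criterion.\<close>

lemma self_notin_after_arrival: "x \<notin> set_pmf (after_arrival G (uniform_policy G) x i)"
  by (auto simp: set_after_arrival fun_upd_idem_iff dest!: sym[of x] fun_upd_idem_iff[THEN iffD1])
    (auto simp: mem_candidates)

lemma queue_value_inc:
  assumes "i \<in> pverts G"
  shows "queue_value G w (x(i := x i + 1)) = queue_value G w x + w i"
  using assms pair_finite_verts unfolding queue_value_def
  by (simp add: sum.remove[of _ i] algebra_simps)

lemma queue_value_dec:
  assumes "j \<in> pverts G" "0 < x j"
  shows "queue_value G w (x(j := x j - 1)) = queue_value G w x - w j"
  using assms pair_finite_verts unfolding queue_value_def
  by (simp add: sum.remove[of _ j] of_nat_diff algebra_simps)

lemma expectation_after_arrival: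
  assumes "i \<in> pverts G"
  shows "measure_pmf.expectation (after_arrival G (uniform_policy G) x i) (queue_value G w) =
    queue_value G w x + arrival_drift G w x i"
proof (cases "candidates G x i = {}")
  case True
  then show ?thesis
    using assms by (simp add: after_arrival_def arrival_drift_def queue_value_inc[simplified])
next
  case False
  let ?C = "candidates G x i"
  have "measure_pmf.expectation (after_arrival G (uniform_policy G) x i) (queue_value G w) =
      (\<Sum>j\<in>?C. queue_value G w (x(j := x j - 1))) / real (card ?C)"
    using False by (simp add: after_arrival_def uniform_policy_def integral_pmf_of_set)
  also have "(\<Sum>j\<in>?C. queue_value G w (x(j := x j - 1))) = (\<Sum>j\<in>?C. queue_value G w x - w j)"
    using candidates_subset[of x i]
    by (intro sum.cong refl queue_value_dec) (blast, simp add: mem_candidates)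
  finally show ?thesis
    using False by (simp add: arrival_drift_def sum_subtractf field_simps)
qed

lemma queue_value_after_arrival_le:
  assumes "i \<in> pverts G" "\<And>v. v \<in> pverts G \<Longrightarrow> \<bar>w v\<bar> \<le> 1"
    and "y \<in> set_pmf (after_arrival G (uniform_policy G) x i)"
  shows "queue_value G w y \<le> queue_value G w x + 1"
proof (cases "candidates G x i = {}")
  case True
  then show ?thesis
    using assms by (auto simp: set_after_arrival queue_value_inc[simplified] abs_le_iff)
next
  case False
  then obtain j where j: "j \<in> candidates G x i" "y = x(j := x j - 1)"
    using assms(3) by (auto simp: set_after_arrival)
  then have "j \<in> pverts G" "0 < x j"
    using candidates_subset[of x i] by (blast, simp add: mem_candidates)
  then show ?thesis
    using assms(2)[of j] by (simp add: j queue_value_dec del: One_nat_def)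
qed

lemma queue_states_after_arrival:
  assumes "x \<in> queue_states G" "i \<in> pverts G"
    and "y \<in> set_pmf (after_arrival G (uniform_policy G) x i)"
  shows "y \<in> queue_states G"
proof (cases "candidates G x i = {}")
  case True
  then have y: "y = x(i := x i + 1)"
    using assms(3) by (simp add: set_after_arrival)
  have "(i, j) \<notin> parcs G \<and> (j, i) \<notin> parcs G" if "0 < x j" for j
    using True that arc_sym[of j i] mem_candidates[of j x i] by blast
  moreover have "(i, i) \<notin> parcs G"
    by (rule loop_free)
  ultimately show ?thesis
    using assms(1,2) unfolding y queue_states_def independent_set_def
    by (auto split: if_splits)
next
  case False
  then obtain j where "y = x(j := x j - 1)"
    using assms(3) by (auto simp: set_after_arrival)
  then have "0 < x k" if "0 < y k" for k
    using that by (auto split: if_splits)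
  then show ?thesis
    using assms(1) by (auto simp: queue_states_def independent_set_def)
qed

end

section \<open>The jump chain of the queue and the criterion for instability\<close>

locale matching_queue = pair_graph G for G :: "'v pair_pre_digraph" +
  fixes lam :: "'v \<Rightarrow> real"
  assumes lam_pos: "v \<in> pverts G \<Longrightarrow> 0 < lam v"
    and verts_nonempty: "pverts G \<noteq> {}"
begin

abbreviation "total_rate \<equiv> sum lam (pverts G)"

abbreviation "rate \<equiv> queue_rate G lam (uniform_policy G)"

lemma total_rate_pos: "0 < total_rate"
  using pair_finite_verts verts_nonempty lam_pos by (intro sum_pos) auto

lemma pmf_arrival_class:
  "pmf (embed_pmf (\<lambda>i. if i \<in> pverts G then lam i / total_rate else 0)) i =
    (if i \<in> pverts G then lam i / total_rate else 0)"
proof (rule pmf_embed_pmf)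
  show "0 \<le> (if i \<in> pverts G then lam i / total_rate else 0)" for i
    using lam_pos total_rate_pos by (auto intro!: divide_nonneg_nonneg less_imp_le)
  have "(\<integral>\<^sup>+i. ennreal (if i \<in> pverts G then lam i / total_rate else 0) \<partial>count_space UNIV) =
      (\<Sum>i\<in>pverts G. ennreal (lam i / total_rate))"
    using pair_finite_verts by (subst nn_integral_count_space'[of "pverts G"]) auto
  also have "\<dots> = ennreal (\<Sum>i\<in>pverts G. lam i / total_rate)"
    using lam_pos total_rate_pos by (intro sum_ennreal) (auto intro!: divide_nonneg_nonneg less_imp_le)
  also have "(\<Sum>i\<in>pverts G. lam i / total_rate) = 1"
    using total_rate_pos by (simp flip: sum_divide_distrib)
  finally show "(\<integral>\<^sup>+i. ennreal (if i \<in> pverts G then lam i / total_rate else 0) \<partial>count_space UNIV) = 1"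
    by simp
qed

lemma set_arrival_class:
  "set_pmf (embed_pmf (\<lambda>i. if i \<in> pverts G then lam i / total_rate else 0)) = pverts G"
  using lam_pos total_rate_pos by (force simp: set_pmf_eq pmf_arrival_class)

lemma set_arrival_step:
  "set_pmf (arrival_step G lam x) = (\<Union>i\<in>pverts G. set_pmf (after_arrival G (uniform_policy G) x i))"
  by (simp add: arrival_step_def set_arrival_class)

lemma queue_rate_eq: "rate x y = total_rate * pmf (arrival_step G lam x) y"
proof -
  have "pmf (arrival_step G lam x) y =
      (\<Sum>i\<in>pverts G. lam i / total_rate * pmf (after_arrival G (uniform_policy G) x i) y)"
    unfolding arrival_step_def pmf_bind
    using pair_finite_verts
    by (subst integral_measure_pmf[of "pverts G"]) (auto simp: set_arrival_class pmf_arrival_class)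
  then show ?thesis
    using total_rate_pos by (simp add: queue_rate_def sum_distrib_left)
qed

lemma pmf_arrival_step_self: "pmf (arrival_step G lam x) x = 0"
  using self_notin_after_arrival by (auto simp: pmf_eq_0_set_pmf set_arrival_step)

lemma exit_rate_queue: "exit_rate rate x = total_rate"
proof -
  have "infsum (pmf (arrival_step G lam x)) (- {x}) = measure (arrival_step G lam x) (- {x})"
    by (subst measure_pmf_conv_infsetsum) (simp add: infsetsum_infsum pmf_abs_summable)
  also have "\<dots> = 1"
    using measure_pmf.prob_compl[of "{x}" "arrival_step G lam x"]
    by (simp add: measure_pmf_single pmf_arrival_step_self Compl_eq_Diff_UNIV)
  finally show ?thesis
    unfolding exit_rate_def queue_rate_eq[abs_def] by (simp add: infsum_cmult_right')
qed

lemma jump_pmf_queue: "jump_pmf rate x = arrival_step G lam x"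
proof -
  have "(\<lambda>y. if y = x then 0 else rate x y / exit_rate rate x) = pmf (arrival_step G lam x)"
    using total_rate_pos
    by (auto simp: exit_rate_queue queue_rate_eq pmf_arrival_step_self)
  moreover have "embed_pmf (pmf p) = p" for p :: "('v \<Rightarrow> nat) pmf"
    by (rule pmf_eqI, subst pmf_embed_pmf) (simp_all add: nn_integral_pmf)
  ultimately show ?thesis
    using total_rate_pos by (simp add: jump_pmf_def exit_rate_queue)
qed

lemma expectation_arrival_step:
  "measure_pmf.expectation (arrival_step G lam x) (queue_value G w) =
    queue_value G w x + (\<Sum>i\<in>pverts G. lam i * arrival_drift G w x i) / total_rate"
proof -
  have "measure_pmf.expectation (arrival_step G lam x) (queue_value G w) =
      (\<Sum>i\<in>pverts G. lam i / total_rate * (queue_value G w x + arrival_drift G w x i))"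
    unfolding arrival_step_def
    by (subst pmf_expectation_bind[of "pverts G"])
      (auto simp: pair_finite_verts finite_set_after_arrival set_arrival_class pmf_arrival_class
        expectation_after_arrival)
  also have "\<dots> = (\<Sum>i\<in>pverts G. lam i / total_rate) * queue_value G w x
      + (\<Sum>i\<in>pverts G. lam i * arrival_drift G w x i) / total_rate"
    by (simp add: distrib_left sum.distrib sum_distrib_right sum_divide_distrib)
  also have "(\<Sum>i\<in>pverts G. lam i / total_rate) = 1"
    using total_rate_pos by (simp flip: sum_divide_distrib)
  finally show ?thesis by simp
qed

text \<open>The empty queue has value 0, and one arrival of class \<open>v0\<close> leads from it to
  a positive value; weights bounded by 1 bound the jumps. So the criterion applies at the empty
  queue, and failure at this one state refutes stability.\<close>

lemma not_stable_uniform: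
  assumes w: "\<And>v. v \<in> pverts G \<Longrightarrow> \<bar>w v\<bar> \<le> 1"
    and v0: "v0 \<in> pverts G" "0 < w v0"
    and drift: "\<And>x. x \<in> queue_states G \<Longrightarrow> 0 < queue_value G w x \<Longrightarrow>
      0 \<le> (\<Sum>i\<in>pverts G. lam i * arrival_drift G w x i)"
  shows "\<not> stable G lam (uniform_policy G)"
proof -
  define B where "B = {x\<in>queue_states G. 0 < queue_value G w x}"
  let ?x0 = "\<lambda>_. 0 :: nat"
  have x0: "?x0 \<in> queue_states G" "queue_value G w ?x0 = 0"
    by (simp_all add: queue_states_def independent_set_def queue_value_def)
  have jump: "queue_value G w y \<le> queue_value G w x + 1" if "y \<in> set_pmf (arrival_step G lam x)" for x y
    using that w by (auto simp: set_arrival_step intro: queue_value_after_arrival_le)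
  have "\<not> positive_recurrent_state rate ?x0"
  proof (rule not_positive_recurrent_stateI[where c = total_rate and B = B and f = "queue_value G w"
        and ?y0.0 = "?x0(v0 := ?x0 v0 + 1)"])
    fix x assume "x \<in> B"
    then have x: "x \<in> queue_states G" "0 < queue_value G w x"
      by (auto simp: B_def)
    let ?K = "arrival_step G lam x"
    have fin: "finite (set_pmf ?K)"
      by (simp add: set_arrival_step finite_set_after_arrival pair_finite_verts)
    have "queue_value G w x \<le> measure_pmf.expectation ?K (queue_value G w)"
      using drift[OF x] total_rate_pos by (simp add: expectation_arrival_step)
    \<comment> \<open>Passing to the positive part can only increase the mean. As transitions stay
      in \<open>queue_states G\<close>, the positive part is the value cut off outside
      \<open>B\<close>.\<close>
    also have "\<dots> \<le> measure_pmf.expectation ?K (\<lambda>y. max 0 (queue_value G w y))"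
      by (intro integral_mono integrable_measure_pmf_finite fin) auto
    finally have "ennreal (queue_value G w x) \<le>
        ennreal (measure_pmf.expectation ?K (\<lambda>y. max 0 (queue_value G w y)))"
      by (rule ennreal_leI)
    also have "\<dots> = (\<integral>\<^sup>+y. ennreal (max 0 (queue_value G w y)) \<partial>?K)"
      by (rule nn_integral_eq_integral[symmetric]) (auto intro: integrable_measure_pmf_finite fin)
    also have "\<dots> = (\<integral>\<^sup>+y. ennreal (queue_value G w y) * indicator B y \<partial>?K)"
    proof (intro nn_integral_cong_AE AE_pmfI)
      fix y assume "y \<in> set_pmf ?K"
      then have "y \<in> queue_states G"
        using queue_states_after_arrival[OF x(1)] by (auto simp: set_arrival_step)
      then show "ennreal (max 0 (queue_value G w y)) = ennreal (queue_value G w y) * indicator B y"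
        by (auto simp: B_def max_def ennreal_neg split: split_indicator)
    qed
    finally show "ennreal (queue_value G w x) \<le>
        (\<integral>\<^sup>+y. ennreal (queue_value G w y) * indicator B y \<partial>jump_pmf rate x)"
      by (simp add: jump_pmf_queue)
  next
    show "?x0(v0 := ?x0 v0 + 1) \<in> set_pmf (jump_pmf rate ?x0)"
      using v0 by (auto simp: jump_pmf_queue set_arrival_step set_after_arrival candidates_def)
    then have "?x0(v0 := ?x0 v0 + 1) \<in> queue_states G"
      using queue_states_after_arrival[OF x0(1)] by (auto simp: jump_pmf_queue set_arrival_step)
    then show "?x0(v0 := ?x0 v0 + 1) \<in> B"
      using v0 queue_value_inc[of v0 w ?x0] x0 by (simp add: B_def)
  qed (use x0 jump exit_rate_queue total_rate_pos in \<open>auto simp: B_def jump_pmf_queue dest: jump[of _ ?x0]\<close>)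
  then show ?thesis
    using x0 by (auto simp: stable_def positive_recurrent_def)
qed

end

section \<open>Unstable intensities\<close>

lemma (in pair_graph) arrival_drift_ge:
  assumes "candidates G x i = {} \<Longrightarrow> l \<le> w i"
    and "\<And>j. j \<in> candidates G x i \<Longrightarrow> w j \<le> - l"
  shows "l \<le> arrival_drift G w x i"
proof (cases "candidates G x i = {}")
  case False
  then have "0 < card (candidates G x i)"
    by (simp add: card_gt_0_iff)
  moreover have "(\<Sum>j\<in>candidates G x i. w j) \<le> real (card (candidates G x i)) * (- l)"
    by (rule sum_bounded_above) (rule assms)
  ultimately show ?thesis
    using False by (simp add: arrival_drift_def field_simps)
qed (use assms in \<open>simp add: arrival_drift_def\<close>)

text \<open>Here the uniformity of the choice enters: among \<open>n >= 2\<close> candidates the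
  heavy one is taken with probability \<open>1 / n\<close>, so the mean weight lost is at most
  \<open>1 / n + (1 - 1 / n) / 2\<close>, which is at most 3/4.\<close>

lemma (in pair_graph) arrival_drift_ge_pair:
  assumes "j \<in> candidates G x i" "k \<in> candidates G x i" "j \<noteq> k"
    and "w j \<le> 1" "\<And>v. v \<in> candidates G x i \<Longrightarrow> v \<noteq> j \<Longrightarrow> w v \<le> 1 / 2"
  shows "- 3 / 4 \<le> arrival_drift G w x i"
proof -
  let ?C = "candidates G x i"
  have card: "2 \<le> card ?C"
    using card_mono[of ?C "{j, k}"] assms(1-3) by simp
  have "(\<Sum>v\<in>?C. w v) = w j + (\<Sum>v\<in>?C - {j}. w v)"
    using assms(1) by (simp add: sum.remove)
  also have "(\<Sum>v\<in>?C - {j}. w v) \<le> real (card (?C - {j})) * (1 / 2)"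
    by (rule sum_bounded_above) (use assms in auto)
  also have "w j + real (card (?C - {j})) * (1 / 2) \<le> 1 + (real (card ?C) - 1) * (1 / 2)"
    using assms card by (simp add: card_Diff_singleton of_nat_diff)
  also have "\<dots> \<le> real (card ?C) * (3 / 4)"
    using card by (simp add: field_simps)
  finally have "(\<Sum>v\<in>?C. w v) \<le> real (card ?C) * (3 / 4)"
    by simp
  moreover have "?C \<noteq> {}"
    using assms(1) by auto
  ultimately show ?thesis
    using card by (simp add: arrival_drift_def field_simps)
qed

lemma (in pair_graph) queue_value_pos:
  assumes "0 < queue_value G w x"
  obtains v where "v \<in> pverts G" "0 < w v" "0 < x v"
proof -
  have "\<exists>v\<in>pverts G. 0 < w v * real (x v)"
    using assms sum_nonpos[of "pverts G" "\<lambda>v. w v * real (x v)"]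
    unfolding queue_value_def by fastforce
  then show ?thesis
    using that by (auto simp: zero_less_mult_iff)
qed

text \<open>Outside \<open>H\<close> the intensities decay geometrically with the distance to \<open>H\<close>. An independent set
  missing \<open>H\<close> is then outweighed by a single neighbour, one step closer to \<open>H\<close> than its closest
  vertex.\<close>

lemma (in pair_graph) Ncond_extension:
  assumes conn: "\<And>u v. u \<in> pverts G \<Longrightarrow> v \<in> pverts G \<Longrightarrow> (u, v) \<in> (parcs G)\<^sup>*"
    and H: "H \<subseteq> pverts G" "H \<noteq> {}"
    and mu: "\<And>v. v \<in> H \<Longrightarrow> 9 / 10 \<le> mu v"
    and gap: "\<And>J. J \<subseteq> H \<Longrightarrow> J \<noteq> {} \<Longrightarrow> independent_set G J \<Longrightarrow>
      sum mu J + 1 / 10 \<le> sum mu (nbrs G J \<inter> H)"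
  obtains lam where "lam \<in> Ncond G" "\<And>v. v \<in> H \<Longrightarrow> lam v = mu v"
    "\<And>v. v \<in> pverts G - H \<Longrightarrow> real (card (pverts G)) * lam v \<le> 1 / 20"
proof -
  let ?V = "pverts G" and ?N = "real (card (pverts G))"
  have fin: "finite ?V" by (rule pair_finite_verts)
  have "?V \<noteq> {}"
    using H by auto
  then have "0 < card ?V"
    using fin by (simp add: card_gt_0_iff)
  then have N: "1 \<le> ?N"
    by simp
  define d where "d v = (LEAST n. \<exists>h\<in>H. (h, v) \<in> parcs G ^^ n)" for v
  \<comment> \<open>With this value all vertices together, each of weight at most \<open>e\<close>,
    weigh at most 1/20, half of the margin on \<open>H\<close>.\<close>
  define e where "e = 1 / (20 * ?N)"
  have e: "0 < e" "e \<le> 1" "?N * e = 1 / 20"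
  proof -
    have "0 < 1 / (20 * n) \<and> 1 / (20 * n) \<le> 1 \<and> n * (1 / (20 * n)) = 1 / 20" if "1 \<le> n" for n :: real
      using that by (simp add: field_simps)
    from this[OF N] show "0 < e" "e \<le> 1" "?N * e = 1 / 20"
      by (simp_all only: e_def)
  qed
  define lam where "lam v = (if v \<in> ?V then if v \<in> H then mu v else e ^ d v else undefined)" for v
  have reach: "\<exists>h\<in>H. (h, v) \<in> parcs G ^^ d v" if v: "v \<in> ?V" for v
  proof -
    obtain h where h: "h \<in> H" "h \<in> ?V"
      using H by auto
    obtain n where "(h, v) \<in> parcs G ^^ n"
      using rtrancl_imp_relpow[OF conn[OF h(2) v]] by blast
    with h have "\<exists>n. \<exists>h\<in>H. (h, v) \<in> parcs G ^^ n"
      by blast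
    then show ?thesis
      unfolding d_def by (rule LeastI_ex)
  qed
  have d_le: "d v \<le> n" if "h \<in> H" "(h, v) \<in> parcs G ^^ n" for h v n
    unfolding d_def using that by (auto intro: Least_le)
  have d_pos: "0 < d v" if "v \<in> ?V - H" for v
    using reach[of v] that by (auto intro!: gr0I)
  have lam_small: "lam v \<le> e ^ n" if "v \<in> ?V - H" "n \<le> d v" for v n
    using that e by (simp add: lam_def power_decreasing)
  have lam_H: "lam v = mu v" if "v \<in> H" for v
    using that H by (auto simp: lam_def)
  have lam_pos: "0 < lam v" if "v \<in> ?V" for v
    using that e mu[of v] by (auto simp: lam_def)
  \<comment> \<open>One power of \<open>e\<close> is spent on the number of vertices: those at
    distance at least \<open>n + 1\<close> weigh at most \<open>e ^ n / 20\<close> in total.\<close>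
  have outside: "sum lam (I - H) \<le> e ^ n / 20"
    if "I \<subseteq> ?V" "\<And>v. v \<in> I - H \<Longrightarrow> Suc n \<le> d v" for I n
  proof -
    have "sum lam (I - H) \<le> real (card (I - H)) * e ^ Suc n"
      by (rule sum_bounded_above) (use that in \<open>blast intro: lam_small\<close>)
    also have "\<dots> \<le> ?N * e ^ Suc n"
      using that fin e by (intro mult_right_mono) (auto intro!: card_mono)
    also have "\<dots> = e ^ n / 20"
      using e(3) by (simp add: mult.assoc[symmetric])
    finally show ?thesis .
  qed
  have "lam \<in> Ncond G"
    unfolding Ncond_def
  proof (intro CollectI conjI allI impI)
    show "lam \<in> ?V \<rightarrow>\<^sub>E {0<..}"
      using lam_pos by (auto simp: lam_def)
  next
    fix I assume "independent_set G I \<and> I \<noteq> {}"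
    then have I: "independent_set G I" "I \<noteq> {}" "I \<subseteq> ?V" "finite I"
      using fin by (auto simp: independent_set_def intro: finite_subset)
    have fin_nbrs: "finite (nbrs G I)"
      using nbrs_subset fin by (rule finite_subset)
    have nbrs_nonneg: "0 \<le> lam v" if "v \<in> nbrs G I" for v
      using that nbrs_subset[of I] lam_pos[of v] by auto
    show "sum lam I < sum lam (nbrs G I)"
    proof (cases "I \<inter> H = {}")
      case False
      \<comment> \<open>The margin 1/10 inside \<open>H\<close> exceeds the at most 1/20 that the
        rest of \<open>I\<close> contributes.\<close>
      have "independent_set G (I \<inter> H)"
        using I(1) by (auto simp: independent_set_def)
      then have "sum mu (I \<inter> H) + 1 / 10 \<le> sum mu (nbrs G (I \<inter> H) \<inter> H)"
        using False by (intro gap) auto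
      also have "\<dots> = sum lam (nbrs G (I \<inter> H) \<inter> H)"
        by (intro sum.cong) (auto simp: lam_H)
      also have "\<dots> \<le> sum lam (nbrs G I)"
        using nbrs_nonneg by (intro sum_mono2 fin_nbrs) (auto simp: nbrs_def)
      also have "sum mu (I \<inter> H) = sum lam (I \<inter> H)"
        by (intro sum.cong) (auto simp: lam_H)
      finally have "sum lam (I \<inter> H) + 1 / 10 \<le> sum lam (nbrs G I)" .
      moreover have "sum lam (I - H) \<le> 1 / 20"
        using outside[of I 0] I d_pos by (auto simp: Suc_le_eq)
      moreover have "sum lam I = sum lam (I \<inter> H) + sum lam (I - H)"
        using I(4) by (rule sum.Int_Diff)
      ultimately show ?thesis by simp
    next
      case True
      have "\<exists>v. v \<in> I \<and> (\<forall>u. u \<in> I \<longrightarrow> d v \<le> d u)"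
        using I(2) ex_has_least_nat[of "\<lambda>v. v \<in> I" _ d] by blast
      then obtain v where v: "v \<in> I" "\<forall>u. u \<in> I \<longrightarrow> d v \<le> d u"
        by blast
      then have vH: "v \<in> ?V - H"
        using I True by auto
      obtain n where dn: "d v = Suc n"
        using d_pos[OF vH] by (cases "d v") auto
      obtain h where n: "h \<in> H" "(h, v) \<in> parcs G ^^ Suc n"
        using reach[of v] vH unfolding dn by blast
      obtain u where u: "(h, u) \<in> parcs G ^^ n" "(u, v) \<in> parcs G"
        using n(2) by (rule relpow_Suc_E)
      have "d u \<le> n"
        using n(1) u(1) by (rule d_le)
      have "u \<in> ?V"
        using u(2) by (rule in_arcsD1)
      \<comment> \<open>The factor 9/10 is the lower bound of \<open>mu\<close> on \<open>H\<close>,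
        where the path may end; outside \<open>H\<close> the weight of \<open>u\<close> is at least
        \<open>e ^ n\<close>.\<close>
      have "e ^ n * (9 / 10) \<le> lam u"
      proof (cases "u \<in> H")
        case True
        have "e ^ n \<le> 1"
          using e by (intro power_le_one) auto
        then show ?thesis
          using mu[OF True] by (simp add: lam_H True)
      next
        case False
        have "e ^ n \<le> e ^ d u"
          using e \<open>d u \<le> n\<close> by (intro power_decreasing) auto
        moreover have "0 < e ^ n"
          using e by simp
        ultimately show ?thesis
          using False \<open>u \<in> ?V\<close> by (simp add: lam_def)
      qed
      have "I - H = I"
        using True by auto
      then have "sum lam I \<le> e ^ n / 20"
        using outside[of I n] I(3) v(2) by (simp add: dn)
      also have "\<dots> < e ^ n * (9 / 10)"
        using e by simp
      also have "\<dots> \<le> lam u" by fact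
      also have "\<dots> \<le> sum lam (nbrs G I)"
        using arc_sym[OF u(2)] v(1)
        by (intro member_le_sum fin_nbrs nbrs_nonneg) (auto simp: nbrs_def)
      finally show ?thesis .
    qed
  qed
  then show ?thesis
  proof (rule that)
    show "lam v = mu v" if "v \<in> H" for v
      using that by (rule lam_H)
    show "?N * lam v \<le> 1 / 20" if "v \<in> ?V - H" for v
    proof -
      have "?N * lam v \<le> ?N * e"
        using lam_small[OF that, of 1] d_pos[OF that] N by (intro mult_left_mono) auto
      then show ?thesis
        using e(3) by simp
    qed
  qed
qed

text \<open>An arrival of any class costs at most 1 in the mean, and the classes outside
  \<open>H\<close> have small total intensity, so the margin in \<open>drift\<close> pays for them.
  The sum in \<open>drift\<close> runs over arrivals in \<open>H\<close> only, but \<open>x\<close>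
  ranges over queues of all classes of \<open>G\<close>.\<close>

lemma (in pair_graph) not_maximal_uniformI:
  assumes conn: "\<And>u v. u \<in> pverts G \<Longrightarrow> v \<in> pverts G \<Longrightarrow> (u, v) \<in> (parcs G)\<^sup>*"
    and H: "H \<subseteq> pverts G"
    and mu: "\<And>v. v \<in> H \<Longrightarrow> 9 / 10 \<le> mu v"
    and gap: "\<And>J. J \<subseteq> H \<Longrightarrow> J \<noteq> {} \<Longrightarrow> independent_set G J \<Longrightarrow>
      sum mu J + 1 / 10 \<le> sum mu (nbrs G J \<inter> H)"
    and w: "\<And>v. v \<in> pverts G \<Longrightarrow> \<bar>w v\<bar> \<le> 1" "v0 \<in> H" "0 < w v0"
    and drift: "\<And>x. x \<in> queue_states G \<Longrightarrow> 0 < queue_value G w x \<Longrightarrow>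
      1 / 10 \<le> (\<Sum>i\<in>H. mu i * arrival_drift G w x i)"
  shows "\<not> maximal G (uniform_policy G)"
proof -
  obtain lam where lam: "lam \<in> Ncond G" "\<And>v. v \<in> H \<Longrightarrow> lam v = mu v"
    and small: "\<And>v. v \<in> pverts G - H \<Longrightarrow> real (card (pverts G)) * lam v \<le> 1 / 20"
    using Ncond_extension[OF conn H _ mu gap] w(2) by blast
  have lam_pos: "0 < lam v" if "v \<in> pverts G" for v
    using lam(1) that by (auto simp: Ncond_def)
  interpret matching_queue G lam
    by unfold_locales (use lam_pos H w(2) in auto)
  have N: "0 < real (card (pverts G))"
    using verts_nonempty pair_finite_verts by (simp add: card_gt_0_iff)
  have "\<not> stable G lam (uniform_policy G)"
  proof (rule not_stable_uniform)
    fix x assume x: "x \<in> queue_states G" "0 < queue_value G w x"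
    have "- 1 / 10 \<le> (\<Sum>i\<in>pverts G - H. lam i * arrival_drift G w x i)"
    proof -
      have "real (card (pverts G - H)) * (- 1 / (20 * real (card (pverts G)))) \<le>
          (\<Sum>i\<in>pverts G - H. lam i * arrival_drift G w x i)"
      proof (rule sum_bounded_below)
        fix i assume i: "i \<in> pverts G - H"
        have "- 1 \<le> arrival_drift G w x i"
        proof (rule arrival_drift_ge)
          show "- 1 \<le> w i"
            using w(1)[of i] i by simp
          show "w j \<le> - (- 1)" if "j \<in> candidates G x i" for j
            using w(1)[of j] that candidates_subset[of x i] by auto
        qed
        then have "lam i * (- 1) \<le> lam i * arrival_drift G w x i"
          using lam_pos[of i] i by (intro mult_left_mono) auto
        moreover have "lam i \<le> 1 / (20 * real (card (pverts G)))"
          using small[OF i] N by (simp add: field_simps)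
        ultimately show "- 1 / (20 * real (card (pverts G))) \<le> lam i * arrival_drift G w x i"
          by simp
      qed
      moreover have "real (card (pverts G - H)) \<le> real (card (pverts G))"
        using pair_finite_verts by (simp add: card_mono)
      moreover have "- 1 / 10 \<le> k * (- 1 / (20 * n))" if "k \<le> n" "0 < n" for k n :: real
        using that by (simp add: field_simps)
      ultimately show ?thesis
        using N by (meson order_trans)
    qed
    moreover have "1 / 10 \<le> (\<Sum>i\<in>H. lam i * arrival_drift G w x i)"
      using drift[OF x] by (simp add: lam(2) cong: sum.cong)
    ultimately show "0 \<le> (\<Sum>i\<in>pverts G. lam i * arrival_drift G w x i)"
      using sum.subset_diff[OF H pair_finite_verts, of "\<lambda>i. lam i * arrival_drift G w x i"] by simp
  qed (use w H in auto)
  then show ?thesis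
    using lam(1) by (auto simp: maximal_def)
qed

lemma (in pair_graph) candidates_nonempty:
  "(i, j) \<in> parcs G \<Longrightarrow> 0 < x j \<Longrightarrow> candidates G x i \<noteq> {}"
  using mem_candidates by blast

lemma (in pair_graph) queue_states_arc:
  "x \<in> queue_states G \<Longrightarrow> (i, j) \<in> parcs G \<Longrightarrow> 0 < x i \<Longrightarrow> x j = 0"
  by (auto simp: queue_states_def independent_set_def intro: gr0I)

text \<open>As long as one of \<open>a\<close>, \<open>b\<close> is queued, class \<open>c\<close> serves \<open>d\<close> at most half of the time, which is
  too little for the intensity \<open>9 / 10\<close> of \<open>d\<close>; and the queues of \<open>a\<close> and \<open>b\<close>, whose intensities
  agree, are rarely both empty. The weight \<open>1 / 2\<close> on \<open>a\<close>, \<open>b\<close> compensates for the times at which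
  they are. Weight \<open>- 1\<close> on all other classes makes every match with one of them a gain.\<close>

lemma (in pair_graph) pendant_not_maximal:
  assumes conn: "\<And>u v. u \<in> pverts G \<Longrightarrow> v \<in> pverts G \<Longrightarrow> (u, v) \<in> (parcs G)\<^sup>*"
    and dist: "distinct [a, b, c, d]" and V: "{a, b, c, d} \<subseteq> pverts G"
    and arcs: "(a, b) \<in> parcs G" "(a, c) \<in> parcs G" "(b, c) \<in> parcs G" "(c, d) \<in> parcs G"
    and non_arcs: "(a, d) \<notin> parcs G" "(b, d) \<notin> parcs G"
  shows "\<not> maximal G (uniform_policy G)"
proof -
  note arcs' = arcs arcs[THEN arc_sym]
  have non_arcs': "(d, a) \<notin> parcs G" "(d, b) \<notin> parcs G"
    using non_arcs by (simp_all add: arcs_commute)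
  \<comment> \<open>The inequality for the set of \<open>d\<close> alone needs \<open>mu d\<close>
    at most \<open>1 - 1 / 10\<close>; the drift below needs at least
    \<open>3 / 4 + 1 / 10\<close>.\<close>
  define mu where "mu v = (if v = d then 9 / 10 else 1 :: real)" for v
  define w where "w v = (if v = d then 1 else if v = a \<or> v = b then 1 / 2 else - 1 :: real)" for v
  have w: "w d = 1" "w a = 1 / 2" "w b = 1 / 2" "w c = - 1"
    using dist by (auto simp: w_def)
  have w_le: "w v \<le> 1" "v \<noteq> d \<Longrightarrow> w v \<le> 1 / 2"
    "v \<noteq> d \<Longrightarrow> v \<noteq> a \<Longrightarrow> v \<noteq> b \<Longrightarrow> w v = - 1" for v
    by (auto simp: w_def)
  show ?thesis
  proof (rule not_maximal_uniformI[OF conn V, where mu = mu and w = w and ?v0.0 = d])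
    fix J assume J: "J \<subseteq> {a, b, c, d}" "J \<noteq> {}" "independent_set G J"
    have sum_H: "sum mu (K \<inter> {a, b, c, d}) =
        (if a \<in> K then 1 else 0) + (if b \<in> K then 1 else 0) + (if c \<in> K then 1 else 0)
        + (if d \<in> K then 9 / 10 else 0)" for K
      unfolding Int_commute[of K] using dist by (subst sum.inter_restrict) (simp_all add: mu_def)
    have indep: "(u, v) \<in> parcs G \<Longrightarrow> \<not> (u \<in> J \<and> v \<in> J)" for u v
      using J(3) by (auto simp: independent_set_def)
    have nbr: "(u, v) \<in> parcs G \<Longrightarrow> u \<in> J \<Longrightarrow> v \<in> nbrs G J" for u v
      by (auto simp: nbrs_def)
    have "J \<inter> {a, b, c, d} = J"
      using J by auto
    then have "sum mu J = (if a \<in> J then 1 else 0) + (if b \<in> J then 1 else 0)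
        + (if c \<in> J then 1 else 0) + (if d \<in> J then 9 / 10 else 0)"
      using sum_H[of J] by simp
    moreover have "a \<in> J \<or> b \<in> J \<or> c \<in> J \<or> d \<in> J"
      using J by auto
    ultimately show "sum mu J + 1 / 10 \<le> sum mu (nbrs G J \<inter> {a, b, c, d})"
      unfolding sum_H using arcs'[THEN indep] arcs'[THEN nbr]
      by (cases "a \<in> J"; cases "b \<in> J"; cases "c \<in> J"; cases "d \<in> J"; simp)
  next
    fix x assume x: "x \<in> queue_states G" "0 < queue_value G w x"
    obtain v where "0 < w v" "0 < x v"
      using x(2) by (rule queue_value_pos)
    then have pos: "0 < x a \<or> 0 < x b \<or> 0 < x d"
      by (auto simp: w_def split: if_splits)
    then have c: "x c = 0"
      using arcs' queue_states_arc[OF x(1)] by blast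
    have ab: "x a = 0 \<or> x b = 0"
      using arcs' queue_states_arc[OF x(1)] by blast
    let ?D = "arrival_drift G w x"
    have D_ge: "l \<le> ?D i"
      if "candidates G x i = {} \<Longrightarrow> l \<le> w i" "\<And>j. (i, j) \<in> parcs G \<Longrightarrow> 0 < x j \<Longrightarrow> w j \<le> - l" for i l
      using that by (intro arrival_drift_ge) (auto simp: mem_candidates)
    have Dd: "1 \<le> ?D d"
      by (rule D_ge) (simp add: w, use c arcs' non_arcs' loop_free in \<open>auto simp: w_def\<close>)
    have Da: "- 1 / 2 \<le> ?D a" and Db: "- 1 / 2 \<le> ?D b"
      by (rule D_ge; use w non_arcs in \<open>auto simp: w_def\<close>)+
    have Da': "1 / 2 \<le> ?D a" if "x b = 0"
      by (rule D_ge) (simp add: w, use that non_arcs loop_free in \<open>auto simp: w_def\<close>)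
    have Db': "1 / 2 \<le> ?D b" if "x a = 0"
      by (rule D_ge) (simp add: w, use that non_arcs loop_free in \<open>auto simp: w_def\<close>)
    have Dc: "- 1 \<le> ?D c"
      by (rule D_ge) (simp_all add: w w_le)
    have Dc': "- 3 / 4 \<le> ?D c" if "0 < x a \<or> 0 < x b"
    proof (cases "0 < x d")
      case True
      have "\<exists>j\<in>{a, b}. 0 < x j"
        using that by auto
      then obtain j where "j \<in> {a, b}" "0 < x j" ..
      then show ?thesis
        using True arcs' dist w_le
        by (intro arrival_drift_ge_pair[of d x c j]) (auto simp: mem_candidates)
    next
      case False
      \<comment> \<open>A candidate exists, so the arriving item is matched and not queued at weight
        -1.\<close>
      have "candidates G x c \<noteq> {}"
        using that arcs' candidates_nonempty by blast
      then have "- 1 / 2 \<le> ?D c"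
        by (intro D_ge) (use False in \<open>auto simp: w_def\<close>)
      then show ?thesis by simp
    qed
    \<comment> \<open>With \<open>a\<close> and \<open>b\<close> empty the bounds add up to 1/2 +
      1/2 - 1 + 9/10; otherwise the contributions of \<open>a\<close> and \<open>b\<close> cancel
      and 9/10 - 3/4 = 3/20 remains.\<close>
    have "1 / 10 \<le> ?D a + ?D b + ?D c + 9 / 10 * ?D d"
    proof (cases "x a = 0 \<and> x b = 0")
      case True
      then show ?thesis
        using Da' Db' Dc Dd by simp
    next
      case False
      then show ?thesis
        using ab Da Da' Db Db' Dc' Dd by auto
    qed
    then show "1 / 10 \<le> (\<Sum>i\<in>{a, b, c, d}. mu i * ?D i)"
      using dist by (simp add: mu_def)
  qed (auto simp: mu_def w_def)
qed

text \<open>Here \<open>a\<close> plays the role of \<open>d\<close> above, and the opposite classes \<open>c\<close>, \<open>d\<close> that of \<open>a\<close>, \<open>b\<close>: an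
  item queued in \<open>c\<close> or \<open>d\<close> diverts half of the service of one of the neighbours of \<open>a\<close>.\<close>

lemma (in pair_graph) pentagon_not_maximal:
  assumes conn: "\<And>u v. u \<in> pverts G \<Longrightarrow> v \<in> pverts G \<Longrightarrow> (u, v) \<in> (parcs G)\<^sup>*"
    and dist: "distinct [a, b, c, d, e]" and V: "{a, b, c, d, e} \<subseteq> pverts G"
    and arcs: "(a, b) \<in> parcs G" "(b, c) \<in> parcs G" "(c, d) \<in> parcs G" "(d, e) \<in> parcs G"
      "(e, a) \<in> parcs G"
    and non_arcs: "(a, c) \<notin> parcs G" "(b, d) \<notin> parcs G" "(c, e) \<notin> parcs G" "(d, a) \<notin> parcs G"
      "(e, b) \<notin> parcs G"
  shows "\<not> maximal G (uniform_policy G)"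
proof -
  note arcs' = arcs arcs[THEN arc_sym]
  have non_arcs': "(c, a) \<notin> parcs G" "(d, b) \<notin> parcs G" "(e, c) \<notin> parcs G" "(a, d) \<notin> parcs G"
      "(b, e) \<notin> parcs G"
    using non_arcs by (simp_all add: arcs_commute)
  \<comment> \<open>The neighbours \<open>b\<close> and \<open>e\<close> of \<open>a\<close> have
    total intensity 2, so the margin allows at most 19/10; with one of them losing 3/4 and the other
    1, the drift needs at least \<open>7 / 4 + 1 / 10\<close>.\<close>
  define mu where "mu v = (if v = a then 19 / 10 else 1 :: real)" for v
  define w where "w v = (if v = a then 1 else if v = c \<or> v = d then 1 / 2 else - 1 :: real)" for v
  have mu: "mu a = 19 / 10" "mu b = 1" "mu c = 1" "mu d = 1" "mu e = 1"
    using dist by (auto simp: mu_def)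
  have w: "w a = 1" "w c = 1 / 2" "w d = 1 / 2" "w b = - 1" "w e = - 1"
    using dist by (auto simp: w_def)
  have w_le: "w v \<le> 1" "v \<noteq> a \<Longrightarrow> w v \<le> 1 / 2" for v
    by (auto simp: w_def)
  show ?thesis
  proof (rule not_maximal_uniformI[OF conn V, where mu = mu and w = w and ?v0.0 = a])
    fix J assume J: "J \<subseteq> {a, b, c, d, e}" "J \<noteq> {}" "independent_set G J"
    have sum_H: "sum mu (K \<inter> {a, b, c, d, e}) =
        (if a \<in> K then 19 / 10 else 0) + (if b \<in> K then 1 else 0) + (if c \<in> K then 1 else 0)
        + (if d \<in> K then 1 else 0) + (if e \<in> K then 1 else 0)" for K
      unfolding Int_commute[of K] using dist by (subst sum.inter_restrict) (auto simp: mu_def)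
    have indep: "(u, v) \<in> parcs G \<Longrightarrow> \<not> (u \<in> J \<and> v \<in> J)" for u v
      using J(3) by (auto simp: independent_set_def)
    have nbr: "(u, v) \<in> parcs G \<Longrightarrow> u \<in> J \<Longrightarrow> v \<in> nbrs G J" for u v
      by (auto simp: nbrs_def)
    have "J \<inter> {a, b, c, d, e} = J"
      using J by auto
    then have "sum mu J = (if a \<in> J then 19 / 10 else 0) + (if b \<in> J then 1 else 0)
        + (if c \<in> J then 1 else 0) + (if d \<in> J then 1 else 0) + (if e \<in> J then 1 else 0)"
      using sum_H[of J] by simp
    moreover have "a \<in> J \<or> b \<in> J \<or> c \<in> J \<or> d \<in> J \<or> e \<in> J"
      using J by auto
    moreover have "a \<in> J \<longrightarrow> b \<in> nbrs G J \<and> e \<in> nbrs G J" "b \<in> J \<longrightarrow> a \<in> nbrs G J \<and> c \<in> nbrs G J"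
      "c \<in> J \<longrightarrow> b \<in> nbrs G J \<and> d \<in> nbrs G J" "d \<in> J \<longrightarrow> c \<in> nbrs G J \<and> e \<in> nbrs G J"
      "e \<in> J \<longrightarrow> a \<in> nbrs G J \<and> d \<in> nbrs G J"
      using arcs'[THEN nbr] by blast+
    ultimately show "sum mu J + 1 / 10 \<le> sum mu (nbrs G J \<inter> {a, b, c, d, e})"
      unfolding sum_H using arcs[THEN indep] by (elim disjE; auto)
  next
    fix x assume x: "x \<in> queue_states G"
    have cd: "x c = 0 \<or> x d = 0"
      using arcs' queue_states_arc[OF x] by blast
    let ?D = "arrival_drift G w x"
    have D_ge: "l \<le> ?D i"
      if "candidates G x i = {} \<Longrightarrow> l \<le> w i" "\<And>j. (i, j) \<in> parcs G \<Longrightarrow> 0 < x j \<Longrightarrow> w j \<le> - l" for i l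
      using that by (intro arrival_drift_ge) (auto simp: mem_candidates)
    have D: "- 1 \<le> ?D i" for i
      by (rule D_ge) (simp_all add: w_def)
    have Da: "1 \<le> ?D a"
      by (rule D_ge) (simp add: w, use non_arcs non_arcs' loop_free in \<open>auto simp: w_def\<close>)
    have Dc: "- 1 / 2 \<le> ?D c" and Dd: "- 1 / 2 \<le> ?D d"
      by (rule D_ge; use w non_arcs non_arcs' in \<open>auto simp: w_def\<close>)+
    have Dc': "1 / 2 \<le> ?D c" if "x d = 0"
      by (rule D_ge) (simp add: w, use that non_arcs' loop_free in \<open>auto simp: w_def\<close>)
    have Dd': "1 / 2 \<le> ?D d" if "x c = 0"
      by (rule D_ge) (simp add: w, use that non_arcs loop_free in \<open>auto simp: w_def\<close>)
    \<comment> \<open>Used with \<open>b\<close> and \<open>c\<close>, or with \<open>e\<close> and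
      \<open>d\<close>, as \<open>i\<close> and \<open>j\<close>: a neighbour of \<open>a\<close>
      that also has a competing class queued.\<close>
    have near: "- 3 / 4 \<le> ?D i" if i: "(i, a) \<in> parcs G" "(i, j) \<in> parcs G" "0 < x j" "j \<noteq> a" for i j
    proof (cases "x a = 0")
      case True
      have "- 1 / 2 \<le> ?D i"
        by (rule D_ge) (use True candidates_nonempty[where x = x, OF i(2,3)] in \<open>auto simp: w_def\<close>)
      then show ?thesis by simp
    next
      case False
      then show ?thesis
        using i w_le by (intro arrival_drift_ge_pair[of a x i j]) (auto simp: mem_candidates)
    qed
    \<comment> \<open>With \<open>c\<close> and \<open>d\<close> empty the bounds add up to 19/10 -
      2 + 1; otherwise \<open>c\<close> and \<open>d\<close> cancel and 19/10 - 3/4 - 1 = 3/20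
      remains.\<close>
    have "1 / 10 \<le> 19 / 10 * ?D a + ?D b + ?D c + ?D d + ?D e"
    proof (cases "x c = 0 \<and> x d = 0")
      case True
      then show ?thesis
        using Da Dc' Dd' D[of b] D[of e] by simp
    next
      case False
      then consider "0 < x c" "x d = 0" | "0 < x d" "x c = 0"
        using cd by auto
      then show ?thesis
      proof cases
        case 1
        have "c \<noteq> a" using dist by auto
        then show ?thesis
          using near[OF arcs'(6,2) 1(1)] Da Dc'[OF 1(2)] Dd D[of e] \<open>c \<noteq> a\<close> by simp
      next
        case 2
        have "d \<noteq> a" using dist by auto
        then show ?thesis
          using near[OF arcs'(5,9) 2(1)] Da Dd'[OF 2(2)] Dc D[of b] \<open>d \<noteq> a\<close> by simp
      qed
    qed
    then show "1 / 10 \<le> (\<Sum>i\<in>{a, b, c, d, e}. mu i * ?D i)"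
      using dist by (simp add: mu)
  qed (auto simp: mu_def w_def)
qed

section \<open>From maximality to separability\<close>

lemma pair_wf_digraph_pendant: "pair_wf_digraph pendant_graph"
  by unfold_locales (auto simp: pendant_graph_def symcl_def)

lemma pair_wf_digraph_cycle: "pair_wf_digraph (cycle_graph n)"
  by unfold_locales (auto simp: cycle_graph_def)

theorem proposition7:
  fixes G :: "'v pair_pre_digraph"
  assumes "G \<in> G7c"
    and "Ncond G \<noteq> {}"
    and "maximal G (uniform_policy G)"
  shows "\<exists>q\<ge>3. separable G q"
proof -
  have G: "pair_graph G" "Digraph_Component.connected (with_proj G)"
    and not_G7: "G \<notin> G7"
    using assms(1) by (auto simp: G7c_def connected_graphs_def)
  interpret pair_graph G by (rule G)
  note conn = connected_rtrancl[OF G(2)]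
  have V: "pverts G \<noteq> {}"
    using G(2) by (auto simp: Digraph_Component.connected_def strongly_connected_def)
  note induces = induces_iff[OF pair_wf_digraph_axioms]
  have no_pendant: "\<not> induces G pendant_graph"
  proof
    assume "induces G pendant_graph"
    then obtain h where h: "inj_on h (pverts pendant_graph)" "h ` pverts pendant_graph \<subseteq> pverts G"
      "\<forall>i\<in>pverts pendant_graph. \<forall>j\<in>pverts pendant_graph.
        (h i, h j) \<in> parcs G \<longleftrightarrow> (i, j) \<in> parcs pendant_graph"
      using induces[OF pair_wf_digraph_pendant] by blast
    have "\<not> maximal G (uniform_policy G)"
    proof (rule pendant_not_maximal[OF conn, of "h 1" "h 2" "h 3" "h 4"])
      show "distinct [h 1, h 2, h 3, h 4]" "{h 1, h 2, h 3, h 4} \<subseteq> pverts G"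
        using h(1,2) by (simp_all add: pendant_graph_def inj_on_def)
    qed (use h(3) in \<open>simp_all add: pendant_graph_def symcl_def\<close>)
    with assms(3) show False by contradiction
  qed
  have no_pentagon: "\<not> induces G (cycle_graph 5)"
  proof
    assume "induces G (cycle_graph 5)"
    then obtain h where h: "inj_on h (pverts (cycle_graph 5))" "h ` pverts (cycle_graph 5) \<subseteq> pverts G"
      "\<forall>i\<in>pverts (cycle_graph 5). \<forall>j\<in>pverts (cycle_graph 5).
        (h i, h j) \<in> parcs G \<longleftrightarrow> (i, j) \<in> parcs (cycle_graph 5)"
      using induces[OF pair_wf_digraph_cycle] by blast
    have five: "pverts (cycle_graph 5) = {0, 1, 2, 3, 4}"
      by (auto simp: cycle_graph_def)
    have "\<not> maximal G (uniform_policy G)"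
    proof (rule pentagon_not_maximal[OF conn, of "h 0" "h 1" "h 2" "h 3" "h 4"])
      show "distinct [h 0, h 1, h 2, h 3, h 4]" "{h 0, h 1, h 2, h 3, h 4} \<subseteq> pverts G"
        using h(1,2) by (simp_all add: five inj_on_def)
    qed (use h(3) five in \<open>simp_all add: cycle_graph_def\<close>)
    with assms(3) show False by contradiction
  qed
  obtain m v where "odd m" "(v, v) \<in> parcs G ^^ m"
    using odd_closed_walk[OF conn V assms(2)] by auto
  then obtain n f where n: "odd n" "3 \<le> n" and f: "inj_on f {..<n}" "f ` {..<n} \<subseteq> pverts G"
    and arcs: "\<And>i j. i < n \<Longrightarrow> j < n \<Longrightarrow> (f i, f j) \<in> parcs G \<longleftrightarrow> (i, j) \<in> parcs (cycle_graph n)"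
    by (rule induced_odd_cycle) blast
  have "pverts (cycle_graph n) = {..<n}"
    by (simp add: cycle_graph_def)
  then have "induces G (cycle_graph n)"
    unfolding induces[OF pair_wf_digraph_cycle] using f arcs by auto
  \<comment> \<open>Without pendant graph and 5-cycle, an induced odd cycle of length at least 7
    would put \<open>G\<close> into \<open>G7\<close>.\<close>
  then have "n \<noteq> 5" "\<not> 7 \<le> n"
    using not_G7 no_pentagon no_pendant n(1) G by (auto simp: G7_def connected_graphs_def)
  with n have "n = 3"
    by presburger
  show ?thesis
  proof (rule separable_if_pendant_free[OF conn])
    show "(f 0, f 1) \<in> parcs G" "(f 0, f 2) \<in> parcs G" "(f 1, f 2) \<in> parcs G"
      by (simp_all add: arcs \<open>n = 3\<close> cycle_graph_def)
  next
    fix a b c d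
    assume abcd: "(a, b) \<in> parcs G" "(a, c) \<in> parcs G" "(b, c) \<in> parcs G" "(c, d) \<in> parcs G"
      "d \<noteq> a" "d \<noteq> b"
    show "(a, d) \<in> parcs G \<or> (b, d) \<in> parcs G"
    proof (rule ccontr)
      assume no: "\<not> ?thesis"
      define h where "h i = (if i = 1 then a else if i = 2 then b else if i = 3 then c else d)" for i :: nat
      have h: "h 1 = a" "h (Suc 0) = a" "h 2 = b" "h 3 = c" "h 4 = d"
        by (simp_all add: h_def)
      have distinct: "a \<noteq> b" "a \<noteq> c" "b \<noteq> c" "c \<noteq> d"
        using abcd loop_free by auto
      note abcd' = abcd(1-4)[THEN arc_sym] arcs_commute[of d a] arcs_commute[of d b]
      have "induces G pendant_graph"
        unfolding induces[OF pair_wf_digraph_pendant]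
      proof (intro exI[of _ h] conjI)
        show "inj_on h (pverts pendant_graph)"
          using distinct abcd(5,6) by (auto simp: pendant_graph_def inj_on_def h)
        show "h ` pverts pendant_graph \<subseteq> pverts G"
          using abcd in_arcsD1 in_arcsD2 by (auto simp: pendant_graph_def h)
        show "\<forall>i\<in>pverts pendant_graph. \<forall>j\<in>pverts pendant_graph.
            (h i, h j) \<in> parcs G \<longleftrightarrow> (i, j) \<in> parcs pendant_graph"
          using abcd abcd' no loop_free by (simp add: pendant_graph_def symcl_def h)
      qed
      with no_pendant show False ..
    qed
  qed
qed

end
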